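(* Let $(X,T)$ be a topological dynamical system, where $X$ is a non-empty compact metric space with metric $d$ and $T:X\to X$ is continuous. Then the following statements are equivalent: (1) $(X,T)$ is uniquely ergodic; (2) $N(F)=X\times X$; (3) $N(\underline F)=X\times X$.
   Context: $S_n$ denotes the group of permutations of $\{1,\dots,n\}$. For $x,y\in X$ define $\overline F(x,y)=\limsup_{n\to+\infty}\inf_{\sigma\in S_n}\frac1n\sum_{k=1}^n d(T^kx,T^{\sigma(k)}y)$ and $\underline F(x,y)=\liminf_{n\to+\infty}\inf_{\sigma\in S_n}\frac1n\sum_{k=1}^n d(T^kx,T^{\sigma(k)}y)$. If $\overline F(x,y)=\underline F(x,y)$, we say $F(x,y)$ exists and denote the common value by $F(x,y)$. $N(F)=\{(x,y)\in X\times X : F(x,y)\text{ exists and } F(x,y)=0\}$ and $N(\underline F)=\{(x,y)\in X\times X:\underline F(x,y)=0\}$. $(X,T)$ is uniquely ergodic if there is exactly one ergodic $T$-invariant regular Borel probability measure on $X$ (equivalently, exactly one $T$-invariant regular Borel probability measure). *)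

theory Defs
  imports "HOL-Probability.Probability"
begin

text \<open>
  The space is a subset \<open>X\<close> of a metric space type, with the metric \<open>dist\<close> and the subspace
  topology of \<open>X\<close>; its Borel sets are those of \<open>restrict_space borel X\<close>.
\<close>

definition regular_measure_on :: "'a::metric_space set \<Rightarrow> 'a measure \<Rightarrow> bool" where
  "regular_measure_on X M \<longleftrightarrow>
     (\<forall>A\<in>sets M.
        emeasure M A = (SUP K\<in>{K. compact K \<and> K \<subseteq> A}. emeasure M K) \<and>
        emeasure M A = (INF U\<in>{U. openin (top_of_set X) U \<and> A \<subseteq> U}. emeasure M U))"

definition regular_borel_prob :: "'a::metric_space set \<Rightarrow> 'a measure \<Rightarrow> bool" where
  "regular_borel_prob X M \<longleftrightarrow>
     sets M = sets (restrict_space borel X) \<and> prob_space M \<and> regular_measure_on X M"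

definition invariant_measure :: "('a \<Rightarrow> 'a) \<Rightarrow> 'a measure \<Rightarrow> bool" where
  "invariant_measure T M \<longleftrightarrow>
     (\<forall>A\<in>sets M. emeasure M (T -` A \<inter> space M) = emeasure M A)"

definition ergodic_measure :: "('a \<Rightarrow> 'a) \<Rightarrow> 'a measure \<Rightarrow> bool" where
  "ergodic_measure T M \<longleftrightarrow>
     invariant_measure T M \<and>
     (\<forall>A\<in>sets M. T -` A \<inter> space M = A \<longrightarrow> measure M A = 0 \<or> measure M A = 1)"

definition uniquely_ergodic :: "'a::metric_space set \<Rightarrow> ('a \<Rightarrow> 'a) \<Rightarrow> bool" where
  "uniquely_ergodic X T \<longleftrightarrow> (\<exists>!M. regular_borel_prob X M \<and> ergodic_measure T M)"

text \<open>
  The infimum ranges over a finite non-empty set, so the conditionally complete infimum on the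
  reals is the intended one.  The value at \<open>n = 0\<close> is immaterial.
\<close>

definition F_avg :: "('a::metric_space \<Rightarrow> 'a) \<Rightarrow> 'a \<Rightarrow> 'a \<Rightarrow> nat \<Rightarrow> real" where
  "F_avg T x y n =
     (INF \<sigma>\<in>{\<sigma>. \<sigma> permutes {1..n}}.
        1 / real n * (\<Sum>k=1..n. dist ((T ^^ k) x) ((T ^^ \<sigma> k) y)))"

definition F_upper :: "('a::metric_space \<Rightarrow> 'a) \<Rightarrow> 'a \<Rightarrow> 'a \<Rightarrow> ereal" where
  "F_upper T x y = limsup (\<lambda>n. ereal (F_avg T x y n))"

definition F_lower :: "('a::metric_space \<Rightarrow> 'a) \<Rightarrow> 'a \<Rightarrow> 'a \<Rightarrow> ereal" where
  "F_lower T x y = liminf (\<lambda>n. ereal (F_avg T x y n))"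

definition F_exists :: "('a::metric_space \<Rightarrow> 'a) \<Rightarrow> 'a \<Rightarrow> 'a \<Rightarrow> bool" where
  "F_exists T x y \<longleftrightarrow> F_upper T x y = F_lower T x y"

text \<open>Meaningful only when \<open>F_exists T x y\<close> holds, i.e. when both limits agree.\<close>

definition F_val :: "('a::metric_space \<Rightarrow> 'a) \<Rightarrow> 'a \<Rightarrow> 'a \<Rightarrow> ereal" where
  "F_val T x y = F_upper T x y"

definition N_F :: "'a::metric_space set \<Rightarrow> ('a \<Rightarrow> 'a) \<Rightarrow> ('a \<times> 'a) set" where
  "N_F X T = {(x, y) \<in> X \<times> X. F_exists T x y \<and> F_val T x y = 0}"

definition N_F_lower :: "'a::metric_space set \<Rightarrow> ('a \<Rightarrow> 'a) \<Rightarrow> ('a \<times> 'a) set" where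
  "N_F_lower X T = {(x, y) \<in> X \<times> X. F_lower T x y = 0}"

end

theory Submission
  imports Defs
begin

text \<open>
  If \<open>F\<close> has lower limit \<open>0\<close> at all pairs, then along suitable times the averages of a continuous
  \<open>f\<close> at any two points are close.  Two invariant measures with different integrals of \<open>f\<close> contradict
  this: if \<open>\<integral>f < c\<close>, some point has all its averages at most \<open>c\<close>, since otherwise compactness
  bounds the first time at which the average exceeds \<open>c\<close>, and chopping orbits into such blocks gives
  \<open>\<integral>f \<ge> c\<close>.

  Conversely, the maximum of \<open>\<integral>f\<close> over invariant measures is attained at an ergodic one (an extreme
  point of the linear functionals below a sublinear functional), so unique ergodicity forces
  \<open>f\<close> to be cohomologous to a constant up to \<open>\<epsilon>\<close> and all averages converge to \<open>\<integral>f\<close>.  Covering \<open>X\<close> by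
  small balls with thin boundary, the orbits of \<open>x\<close> and \<open>y\<close> visit every atom of the generated
  partition with nearly the same frequency, and a permutation maximising the number of times at which
  both are in the same atom shows \<open>F(x, y) = 0\<close>.
\<close>

section \<open>Extreme functionals below a sublinear functional\<close>

text \<open>Since \<open>uniquely_ergodic\<close> counts ergodic measures only, each maximum of an
  integral must be attained at an ergodic one. A single Zorn argument gives existence, maximality
  and extremality together: it runs over sublinear functionals ordered pointwise, where a minimal
  face is a single linear functional. The functional it starts from is the infimum over continuous
  \<open>h\<close> of the supremum of \<open>f + h - h o T\<close>. Domination by it encodes
  positivity, normalisation and invariance at once, and along an orbit the coboundary telescopes to
  a bounded error.

  Averages of continuous functions converge, but matching orbits needs frequencies of sets. This is
  why the cells have indicators squeezed between continuous functions of nearly equal mean.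

  In the converse, \<open>F_lower\<close> gives small values only at times that depend on the pair.
  The point found for each measure therefore obeys its bound at every positive time, so that both
  bounds are available at any such time.\<close>

definition function_subspace :: "('a \<Rightarrow> real) set \<Rightarrow> bool" where
  "function_subspace V \<longleftrightarrow> (\<lambda>x. 0) \<in> V \<and> (\<forall>f\<in>V. \<forall>g\<in>V. (\<lambda>x. f x + g x) \<in> V) \<and>
     (\<forall>f\<in>V. \<forall>c. (\<lambda>x. c * f x) \<in> V)"

definition sublinear_on :: "('a \<Rightarrow> real) set \<Rightarrow> (('a \<Rightarrow> real) \<Rightarrow> real) \<Rightarrow> bool" where
  "sublinear_on V p \<longleftrightarrow> (\<forall>f\<in>V. \<forall>g\<in>V. p (\<lambda>x. f x + g x) \<le> p f + p g) \<and>
     (\<forall>f\<in>V. \<forall>c\<ge>0. p (\<lambda>x. c * f x) \<le> c * p f)"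

definition linear_functional_on :: "('a \<Rightarrow> real) set \<Rightarrow> (('a \<Rightarrow> real) \<Rightarrow> real) \<Rightarrow> bool" where
  "linear_functional_on V L \<longleftrightarrow> (\<forall>f\<in>V. \<forall>g\<in>V. L (\<lambda>x. f x + g x) = L f + L g) \<and>
     (\<forall>f\<in>V. \<forall>c. L (\<lambda>x. c * f x) = c * L f)"

definition dominated_on :: "('a \<Rightarrow> real) set \<Rightarrow> (('a \<Rightarrow> real) \<Rightarrow> real) \<Rightarrow> (('a \<Rightarrow> real) \<Rightarrow> real) \<Rightarrow> bool" where
  "dominated_on V L p \<longleftrightarrow> (\<forall>f\<in>V. L f \<le> p f)"

definition extreme_dominated :: "('a \<Rightarrow> real) set \<Rightarrow> (('a \<Rightarrow> real) \<Rightarrow> real) \<Rightarrow> (('a \<Rightarrow> real) \<Rightarrow> real) \<Rightarrow> bool" where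
  "extreme_dominated V p L \<longleftrightarrow> linear_functional_on V L \<and> dominated_on V L p \<and>
     (\<forall>L1 L2 s. linear_functional_on V L1 \<longrightarrow> linear_functional_on V L2 \<longrightarrow>
        dominated_on V L1 p \<longrightarrow> dominated_on V L2 p \<longrightarrow> 0 < s \<longrightarrow> s < 1 \<longrightarrow>
        (\<forall>f\<in>V. L f = s * L1 f + (1 - s) * L2 f) \<longrightarrow> (\<forall>f\<in>V. L1 f = L f))"

text \<open>
  A sublinear functional is identified with the convex set of linear functionals below it; the
  last clause says that this set is a face.  The functionals vanish off \<open>V\<close> so that the
  pointwise order is antisymmetric.
\<close>

definition face_functional :: "('a \<Rightarrow> real) set \<Rightarrow> (('a \<Rightarrow> real) \<Rightarrow> real) \<Rightarrow> (('a \<Rightarrow> real) \<Rightarrow> real) \<Rightarrow> bool" where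
  "face_functional V p q \<longleftrightarrow> sublinear_on V q \<and> dominated_on V q p \<and> (\<forall>f. f \<notin> V \<longrightarrow> q f = 0) \<and>
     (\<forall>L1 L2 s. linear_functional_on V L1 \<longrightarrow> linear_functional_on V L2 \<longrightarrow>
        dominated_on V L1 p \<longrightarrow> dominated_on V L2 p \<longrightarrow> 0 < s \<longrightarrow> s < 1 \<longrightarrow>
        dominated_on V (\<lambda>f. s * L1 f + (1 - s) * L2 f) q \<longrightarrow>
        dominated_on V L1 q \<and> dominated_on V L2 q)"

text \<open>Cuts the face down to the functionals \<open>L\<close> with \<open>L f = q f\<close>.\<close>

definition tilt :: "('a \<Rightarrow> real) set \<Rightarrow> (('a \<Rightarrow> real) \<Rightarrow> real) \<Rightarrow> ('a \<Rightarrow> real) \<Rightarrow> ('a \<Rightarrow> real) \<Rightarrow> real" where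
  "tilt V q f g = (if g \<in> V then INF t\<in>{0..}. q (\<lambda>x. g x + t * f x) - t * q f else 0)"

context
  fixes V :: "('a \<Rightarrow> real) set"
  assumes V: "function_subspace V"
begin

lemma subspace_zero: "(\<lambda>x. 0) \<in> V"
  and subspace_add: "f \<in> V \<Longrightarrow> g \<in> V \<Longrightarrow> (\<lambda>x. f x + g x) \<in> V"
  and subspace_scale: "f \<in> V \<Longrightarrow> (\<lambda>x. c * f x) \<in> V"
  using V by (auto simp: function_subspace_def)

lemma subspace_minus: "f \<in> V \<Longrightarrow> (\<lambda>x. - f x) \<in> V"
  using subspace_scale[of f "-1"] by simp

lemma sublinear_add: "sublinear_on V q \<Longrightarrow> f \<in> V \<Longrightarrow> g \<in> V \<Longrightarrow> q (\<lambda>x. f x + g x) \<le> q f + q g"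
  by (auto simp: sublinear_on_def)

lemma sublinear_scale_le: "sublinear_on V q \<Longrightarrow> f \<in> V \<Longrightarrow> 0 \<le> c \<Longrightarrow> q (\<lambda>x. c * f x) \<le> c * q f"
  by (auto simp: sublinear_on_def)

lemma sublinear_zero:
  assumes "sublinear_on V q" shows "q (\<lambda>x. 0) = 0"
  using sublinear_add[OF assms subspace_zero subspace_zero]
    sublinear_scale_le[OF assms subspace_zero, of 0] by simp

lemma sublinear_minus:
  assumes "sublinear_on V q" "f \<in> V" shows "- q (\<lambda>x. - f x) \<le> q f"
  using sublinear_add[OF assms subspace_minus[OF assms(2)]] sublinear_zero[OF assms(1)] by simp

text \<open>The definition of \<open>sublinear_on\<close> only has an inequality; applying it with
  the factor \<open>1/c\<close> gives the reverse one.\<close>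

lemma sublinear_scale:
  assumes q: "sublinear_on V q" and f: "f \<in> V" and c: "0 \<le> c"
  shows "q (\<lambda>x. c * f x) = c * q f"
proof (cases "c = 0")
  case True
  then show ?thesis using sublinear_zero[OF q] by simp
next
  case False
  have "q (\<lambda>x. (1/c) * (c * f x)) \<le> (1/c) * q (\<lambda>x. c * f x)"
    using c by (intro sublinear_scale_le[OF q subspace_scale[OF f]]) simp
  then have "c * q f \<le> q (\<lambda>x. c * f x)" using False c by (simp add: field_simps)
  then show ?thesis using sublinear_scale_le[OF q f c] by simp
qed

text \<open>Subadditivity for \<open>t * f = (g + t * f) + (- g)\<close> gives the lower bound
  \<open>- q (- g)\<close>, independent of \<open>t\<close>, so the real infimum in
  \<open>tilt\<close> is a genuine one.\<close>

lemma tilt_bdd: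
  assumes q: "sublinear_on V q" and f: "f \<in> V" and g: "g \<in> V"
  shows "bdd_below ((\<lambda>t. q (\<lambda>x. g x + t * f x) - t * q f) ` {0..})"
proof (rule bdd_belowI2)
  fix t :: real assume t: "t \<in> {0..}"
  have "q (\<lambda>x. (g x + t * f x) + - g x) \<le> q (\<lambda>x. g x + t * f x) + q (\<lambda>x. - g x)"
    by (intro sublinear_add[OF q] subspace_add subspace_scale subspace_minus f g)
  then show "- q (\<lambda>x. - g x) \<le> q (\<lambda>x. g x + t * f x) - t * q f"
    using sublinear_scale[OF q f, of t] t by (simp add: algebra_simps)
qed

lemma tilt_le:
  assumes "sublinear_on V q" "f \<in> V" "g \<in> V" "0 \<le> t"
  shows "tilt V q f g \<le> q (\<lambda>x. g x + t * f x) - t * q f"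
  using cINF_lower[OF tilt_bdd[OF assms(1-3)], of t] assms by (simp add: tilt_def)

lemma tilt_ge:
  assumes "g \<in> V" "\<And>t. 0 \<le> t \<Longrightarrow> c \<le> q (\<lambda>x. g x + t * f x) - t * q f"
  shows "c \<le> tilt V q f g"
  using assms by (auto simp: tilt_def intro!: cINF_greatest)

lemma tilt_le_self:
  assumes "sublinear_on V q" "f \<in> V" "g \<in> V"
  shows "tilt V q f g \<le> q g"
  using tilt_le[OF assms, of 0] by simp

text \<open>The value \<open>t = 1\<close> cancels \<open>- f\<close> against \<open>f\<close>. For
  a linear \<open>L\<close> below the tilt this reads \<open>L f \<ge> q f\<close>, so
  \<open>L\<close> is maximal at \<open>f\<close>.\<close>

lemma tilt_minus:
  assumes "sublinear_on V q" "f \<in> V"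
  shows "tilt V q f (\<lambda>x. - f x) \<le> - q f"
  using tilt_le[OF assms subspace_minus[OF assms(2)], of 1] sublinear_zero[OF assms(1)] by simp

text \<open>The parameters add up: \<open>t\<close> for \<open>g\<close> and \<open>s\<close> for
  \<open>h\<close> make \<open>t + s\<close> admissible for the sum. For homogeneity
  \<open>t\<close> is rescaled to \<open>c * t\<close>.\<close>

lemma sublinear_tilt:
  assumes q: "sublinear_on V q" and f: "f \<in> V"
  shows "sublinear_on V (tilt V q f)"
  unfolding sublinear_on_def
proof (intro conjI ballI allI impI)
  fix g h assume g: "g \<in> V" and h: "h \<in> V"
  have *: "tilt V q f (\<lambda>x. g x + h x) \<le>
      (q (\<lambda>x. g x + t * f x) - t * q f) + (q (\<lambda>x. h x + s * f x) - s * q f)"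
    if "0 \<le> t" "0 \<le> s" for t s
  proof -
    have "q (\<lambda>x. (g x + t * f x) + (h x + s * f x)) \<le> q (\<lambda>x. g x + t * f x) + q (\<lambda>x. h x + s * f x)"
      by (intro sublinear_add[OF q] subspace_add subspace_scale f g h)
    moreover have "(\<lambda>x. (g x + t * f x) + (h x + s * f x)) = (\<lambda>x. (g x + h x) + (t + s) * f x)"
      by (auto simp: algebra_simps)
    ultimately show ?thesis
      using tilt_le[OF q f subspace_add[OF g h], of "t + s"] that by (simp add: algebra_simps)
  qed
  have "tilt V q f (\<lambda>x. g x + h x) - (q (\<lambda>x. g x + t * f x) - t * q f) \<le> tilt V q f h"
    if "0 \<le> t" for t
    using *[OF that] by (intro tilt_ge[OF h]) (simp add: algebra_simps)
  then have "tilt V q f (\<lambda>x. g x + h x) - tilt V q f h \<le> tilt V q f g"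
    by (intro tilt_ge[OF g]) (simp add: algebra_simps)
  then show "tilt V q f (\<lambda>x. g x + h x) \<le> tilt V q f g + tilt V q f h" by simp
next
  fix g and c :: real assume g: "g \<in> V" and c: "0 \<le> c"
  show "tilt V q f (\<lambda>x. c * g x) \<le> c * tilt V q f g"
  proof (cases "c = 0")
    case True
    then show ?thesis
      using tilt_le_self[OF q f subspace_zero] sublinear_zero[OF q] by simp
  next
    case False
    with c have c: "0 < c" by simp
    have "(1 / c) * tilt V q f (\<lambda>x. c * g x) \<le> tilt V q f g"
    proof (rule tilt_ge[OF g])
      fix t :: real assume t: "0 \<le> t"
      have "tilt V q f (\<lambda>x. c * g x) \<le> q (\<lambda>x. c * g x + (c * t) * f x) - (c * t) * q f"
        using c t by (intro tilt_le[OF q f subspace_scale[OF g]]) simp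
      also have "(\<lambda>x. c * g x + (c * t) * f x) = (\<lambda>x. c * (g x + t * f x))"
        by (auto simp: algebra_simps)
      also have "q \<dots> = c * q (\<lambda>x. g x + t * f x)"
        using c by (intro sublinear_scale[OF q subspace_add[OF g subspace_scale[OF f]]]) simp
      finally show "1 / c * tilt V q f (\<lambda>x. c * g x) \<le> q (\<lambda>x. g x + t * f x) - t * q f"
        using c by (simp add: field_simps)
    qed
    then show ?thesis using c by (simp add: field_simps)
  qed
qed

lemma dominated_linear_tilt:
  assumes q: "sublinear_on V q" and f: "f \<in> V"
    and L: "linear_functional_on V L" "dominated_on V L q" "q f \<le> L f"
  shows "dominated_on V L (tilt V q f)"
  unfolding dominated_on_def
proof
  fix g assume g: "g \<in> V"
  have Lf: "L f = q f" using L f by (auto simp: dominated_on_def intro: antisym)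
  show "L g \<le> tilt V q f g"
  proof (rule tilt_ge[OF g])
    fix t :: real assume t: "0 \<le> t"
    have "L (\<lambda>x. g x + t * f x) = L g + t * L f"
      using L(1) f g subspace_scale[OF f, of t] by (simp add: linear_functional_on_def)
    moreover have "L (\<lambda>x. g x + t * f x) \<le> q (\<lambda>x. g x + t * f x)"
      using L(2) subspace_add[OF g subspace_scale[OF f]] by (simp add: dominated_on_def)
    ultimately show "L g \<le> q (\<lambda>x. g x + t * f x) - t * q f" using Lf by simp
  qed
qed

text \<open>If a proper convex combination of two functionals below \<open>q\<close> reaches the
  maximal value \<open>q f\<close>, both of them must reach it. Thus the maximisers of a linear
  evaluation form a face of the given face.\<close>

lemma face_tilt:
  assumes q: "face_functional V p q" and f: "f \<in> V"
  shows "face_functional V p (tilt V q f)"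
proof -
  have sub: "sublinear_on V q" using q by (simp add: face_functional_def)
  show ?thesis
    unfolding face_functional_def
  proof (intro conjI allI impI)
    show "sublinear_on V (tilt V q f)" using sub f by (rule sublinear_tilt)
    show "dominated_on V (tilt V q f) p"
      using q tilt_le_self[OF sub f] unfolding face_functional_def dominated_on_def by force
    show "tilt V q f g = 0" if "g \<notin> V" for g using that by (simp add: tilt_def)
    fix L1 L2 :: "('a \<Rightarrow> real) \<Rightarrow> real" and s :: real
    assume L: "linear_functional_on V L1" "linear_functional_on V L2"
      "dominated_on V L1 p" "dominated_on V L2 p" and s: "0 < s" "s < 1"
      and dom: "dominated_on V (\<lambda>f. s * L1 f + (1 - s) * L2 f) (tilt V q f)"
    have "dominated_on V (\<lambda>f. s * L1 f + (1 - s) * L2 f) q"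
      using dom tilt_le_self[OF sub f] unfolding dominated_on_def by force
    with q L s have L1: "dominated_on V L1 q" and L2: "dominated_on V L2 q"
      unfolding face_functional_def by blast+
    have "L1 (\<lambda>x. - f x) = - L1 f" "L2 (\<lambda>x. - f x) = - L2 f"
      using L f by (auto simp: linear_functional_on_def dest!: bspec[where x = f] spec[where x = "-1"])
    moreover have "s * L1 (\<lambda>x. - f x) + (1 - s) * L2 (\<lambda>x. - f x) \<le> - q f"
      using dom tilt_minus[OF sub f] subspace_minus[OF f] unfolding dominated_on_def by force
    ultimately have *: "q f \<le> s * L1 f + (1 - s) * L2 f" by simp
    have le: "L1 f \<le> q f" "L2 f \<le> q f" using L1 L2 f by (auto simp: dominated_on_def)
    have "s * L1 f \<le> s * q f" "(1 - s) * L2 f \<le> (1 - s) * q f"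
      using le s by (auto intro!: mult_left_mono)
    with * have "s * q f \<le> s * L1 f" "(1 - s) * q f \<le> (1 - s) * L2 f"
      by (auto simp: algebra_simps)
    with s have "q f \<le> L1 f" "q f \<le> L2 f" by auto
    then show "dominated_on V L1 (tilt V q f)" "dominated_on V L2 (tilt V q f)"
      using dominated_linear_tilt[OF sub f] L L1 L2 by auto
  qed
qed

text \<open>The pointwise infimum is bounded below because every member satisfies
  \<open>q f \<ge> - p (- f)\<close>. The chain condition enters in subadditivity: nearly optimal
  members \<open>q\<close> for \<open>f\<close> and \<open>r\<close> for \<open>g\<close> can be
  replaced by the smaller of the two.\<close>

lemma face_chain_Inf:
  assumes ne: "Q \<noteq> {}" and face: "\<And>q. q \<in> Q \<Longrightarrow> face_functional V p q"
    and chain: "\<And>q r. q \<in> Q \<Longrightarrow> r \<in> Q \<Longrightarrow> dominated_on V q r \<or> dominated_on V r q"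
  shows "\<exists>u. face_functional V p u \<and> (\<forall>q\<in>Q. dominated_on V u q)"
proof -
  define u where "u f = (if f \<in> V then INF q\<in>Q. q f else 0)" for f
  have bdd: "bdd_below ((\<lambda>q. q f) ` Q)" if f: "f \<in> V" for f
  proof (rule bdd_belowI2)
    fix q assume q: "q \<in> Q"
    have "- q (\<lambda>x. - f x) \<le> q f" "q (\<lambda>x. - f x) \<le> p (\<lambda>x. - f x)"
      using sublinear_minus[OF _ f] face[OF q] subspace_minus[OF f]
      by (auto simp: face_functional_def dominated_on_def)
    then show "- p (\<lambda>x. - f x) \<le> q f" by simp
  qed
  have u_le: "u f \<le> q f" if "f \<in> V" "q \<in> Q" for f q
    using cINF_lower[OF bdd[OF that(1)] that(2)] that by (simp add: u_def)
  have u_ge: "c \<le> u f" if "f \<in> V" "\<And>q. q \<in> Q \<Longrightarrow> c \<le> q f" for f c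
    using ne that by (auto simp: u_def intro!: cINF_greatest)
  have "face_functional V p u"
    unfolding face_functional_def
  proof (intro conjI allI impI)
    show "sublinear_on V u"
      unfolding sublinear_on_def
    proof (intro conjI ballI allI impI)
      fix f g assume f: "f \<in> V" and g: "g \<in> V"
      have *: "u (\<lambda>x. f x + g x) \<le> q f + r g" if q: "q \<in> Q" and r: "r \<in> Q" for q r
      proof -
        obtain w where w: "w \<in> Q" "w f \<le> q f" "w g \<le> r g"
          using chain[OF q r] q r f g unfolding dominated_on_def by (metis order_refl)
        have "u (\<lambda>x. f x + g x) \<le> w (\<lambda>x. f x + g x)" by (rule u_le[OF subspace_add[OF f g] w(1)])
        also have "\<dots> \<le> w f + w g"
          using sublinear_add[OF _ f g] face[OF w(1)] by (simp add: face_functional_def)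
        finally show ?thesis using w by simp
      qed
      have "u (\<lambda>x. f x + g x) - q f \<le> u g" if "q \<in> Q" for q
        using *[OF that] by (intro u_ge[OF g]) (simp add: algebra_simps)
      then have "u (\<lambda>x. f x + g x) - u g \<le> u f"
        by (intro u_ge[OF f]) (simp add: algebra_simps)
      then show "u (\<lambda>x. f x + g x) \<le> u f + u g" by simp
    next
      fix f and c :: real assume f: "f \<in> V" and c: "0 \<le> c"
      have *: "u (\<lambda>x. c * f x) \<le> c * q f" if q: "q \<in> Q" for q
        using u_le[OF subspace_scale[OF f, of c] q] sublinear_scale_le[OF _ f c, of q] face[OF q]
        by (simp add: face_functional_def)
      show "u (\<lambda>x. c * f x) \<le> c * u f"
      proof (cases "c = 0")
        case True
        then show ?thesis using * ne by auto
      next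
        case False
        with c have "u (\<lambda>x. c * f x) / c \<le> u f"
          using * by (intro u_ge[OF f]) (simp add: field_simps)
        with c False show ?thesis by (simp add: field_simps)
      qed
    qed
    obtain q where q: "q \<in> Q" using ne by auto
    have "u f \<le> p f" if "f \<in> V" for f
    proof -
      have "q f \<le> p f" using that face[OF q] by (simp add: face_functional_def dominated_on_def)
      then show ?thesis using u_le[OF that q] by simp
    qed
    then show "dominated_on V u p" by (simp add: dominated_on_def)
    show "u f = 0" if "f \<notin> V" for f using that by (simp add: u_def)
    fix L1 L2 :: "('a \<Rightarrow> real) \<Rightarrow> real" and s :: real
    assume L: "linear_functional_on V L1" "linear_functional_on V L2"
      "dominated_on V L1 p" "dominated_on V L2 p" and s: "0 < s" "s < 1"
      and dom: "dominated_on V (\<lambda>f. s * L1 f + (1 - s) * L2 f) u"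
    have "dominated_on V L1 q \<and> dominated_on V L2 q" if q: "q \<in> Q" for q
    proof -
      have "dominated_on V (\<lambda>f. s * L1 f + (1 - s) * L2 f) q"
        using dom u_le[OF _ q] unfolding dominated_on_def by force
      then show ?thesis using face[OF q] L s unfolding face_functional_def by blast
    qed
    then show "dominated_on V L1 u" "dominated_on V L2 u"
      unfolding dominated_on_def by (blast intro: u_ge)+
  qed
  then show ?thesis using u_le unfolding dominated_on_def by blast
qed

text \<open>A minimal face equals all of its tilts, hence is odd, hence linear. Starting Zorn below
  the tilt at \<open>f0\<close> rather than below \<open>p\<close> forces the value
  \<open>p f0\<close>.\<close>

theorem extreme_dominated_functional_exists:
  assumes p: "sublinear_on V p" and f0: "f0 \<in> V"
  obtains L where "extreme_dominated V p L" "L f0 = p f0"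
proof -
  define p' where "p' f = (if f \<in> V then p f else 0)" for f
  have p'V: "p' f = p f" if "f \<in> V" for f using that by (simp add: p'_def)
  have p': "face_functional V p p'"
    using p subspace_add subspace_scale
    unfolding face_functional_def sublinear_on_def dominated_on_def p'_def by auto
  define p1 where "p1 = tilt V p' f0"
  have p1: "face_functional V p p1" unfolding p1_def by (rule face_tilt[OF p' f0])
  define A where "A = {q. face_functional V p q \<and> dominated_on V q p1}"
  define R where "R q r \<longleftrightarrow> dominated_on V r q" for q r :: "('a \<Rightarrow> real) \<Rightarrow> real"
  have "\<exists>m\<in>A. \<forall>a\<in>A. R m a \<longrightarrow> a = m"
  proof (rule predicate_Zorn)
    show "partial_order_on A (relation_of R A)"
    proof (rule partial_order_on_relation_ofI)
      show "R a a" for a by (simp add: R_def dominated_on_def)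
      show "R a c" if "R a b" "R b c" for a b c
        using that unfolding R_def dominated_on_def by force
      show "a = b" if "a \<in> A" "b \<in> A" "R a b" "R b a" for a b
      proof
        fix f show "a f = b f"
          using that unfolding A_def R_def dominated_on_def face_functional_def
          by (cases "f \<in> V") (force intro: antisym)+
      qed
    qed
    fix Q assume Q: "Q \<in> Chains (relation_of R A)"
    show "\<exists>u\<in>A. \<forall>a\<in>Q. R a u"
    proof (cases "Q = {}")
      case True
      then show ?thesis using p1 by (auto simp: A_def dominated_on_def intro!: bexI[of _ p1])
    next
      case False
      have QA: "Q \<subseteq> A" using Q by (auto simp: Chains_def relation_of_def)
      have "\<exists>u. face_functional V p u \<and> (\<forall>q\<in>Q. dominated_on V u q)"
      proof (rule face_chain_Inf[OF False])
        show "face_functional V p q" if "q \<in> Q" for q using that QA by (auto simp: A_def)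
        show "dominated_on V q r \<or> dominated_on V r q" if "q \<in> Q" "r \<in> Q" for q r
          using that Q by (auto simp: Chains_def relation_of_def R_def)
      qed
      then obtain u where u: "face_functional V p u" "\<forall>q\<in>Q. dominated_on V u q" by blast
      obtain q where "q \<in> Q" using False by auto
      then have "dominated_on V u p1" using u QA unfolding A_def dominated_on_def by force
      then show ?thesis using u by (auto simp: A_def R_def)
    qed
  qed
  then obtain m where mA: "m \<in> A" and min: "\<And>a. a \<in> A \<Longrightarrow> dominated_on V a m \<Longrightarrow> a = m"
    by (auto simp: R_def)
  have m: "face_functional V p m" and sub: "sublinear_on V m"
    using mA by (auto simp: A_def face_functional_def)
  \<comment> \<open>The tilt is again a face below \<open>m\<close>, so minimality leaves no room;
    with \<open>tilt_minus\<close> this yields \<open>m (- f) \<le> - m f\<close>.\<close>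
  have tilt_m: "tilt V m f = m" if f: "f \<in> V" for f
  proof (rule min)
    show dom: "dominated_on V (tilt V m f) m"
      using tilt_le_self[OF sub f] by (simp add: dominated_on_def)
    then show "tilt V m f \<in> A"
      using face_tilt[OF m f] mA unfolding A_def dominated_on_def by force
  qed
  have neg: "m (\<lambda>x. - f x) = - m f" if f: "f \<in> V" for f
    using tilt_minus[OF sub f] tilt_m[OF f] sublinear_minus[OF sub f] by simp
  have lin: "linear_functional_on V m"
    unfolding linear_functional_on_def
  proof (intro conjI ballI allI)
    fix f g assume f: "f \<in> V" and g: "g \<in> V"
    have "m (\<lambda>x. - f x + - g x) \<le> m (\<lambda>x. - f x) + m (\<lambda>x. - g x)"
      by (intro sublinear_add[OF sub] subspace_minus f g)
    moreover have "m (\<lambda>x. - f x + - g x) = - m (\<lambda>x. f x + g x)"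
      using neg[OF subspace_add[OF f g]] by (simp add: add.commute)
    ultimately show "m (\<lambda>x. f x + g x) = m f + m g"
      using sublinear_add[OF sub f g] neg[OF f] neg[OF g] by simp
  next
    fix f and c :: real assume f: "f \<in> V"
    show "m (\<lambda>x. c * f x) = c * m f"
    proof (cases "0 \<le> c")
      case True then show ?thesis by (rule sublinear_scale[OF sub f])
    next
      case False
      then have "m (\<lambda>x. (- c) * f x) = (- c) * m f" by (intro sublinear_scale[OF sub f]) simp
      then show ?thesis using neg[OF subspace_scale[OF f, of "- c"]] by simp
    qed
  qed
  have dom: "dominated_on V m p" using m by (simp add: face_functional_def)
  have "extreme_dominated V p m"
    unfolding extreme_dominated_def
  proof (intro conjI lin dom allI impI)
    fix L1 L2 :: "('a \<Rightarrow> real) \<Rightarrow> real" and s :: real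
    assume L: "linear_functional_on V L1" "linear_functional_on V L2"
      "dominated_on V L1 p" "dominated_on V L2 p" and s: "0 < s" "s < 1"
      and eq: "\<forall>f\<in>V. m f = s * L1 f + (1 - s) * L2 f"
    \<comment> \<open>The face property of \<open>m\<close> puts \<open>L1\<close> below
      \<open>m\<close>; two linear functionals with one below the other are equal, as
      \<open>- f\<close> shows.\<close>
    have "dominated_on V (\<lambda>f. s * L1 f + (1 - s) * L2 f) m" using eq by (simp add: dominated_on_def)
    then have L1: "dominated_on V L1 m" using m L s unfolding face_functional_def by blast
    show "\<forall>f\<in>V. L1 f = m f"
    proof
      fix f assume f: "f \<in> V"
      have "L1 (\<lambda>x. - f x) = - L1 f"
        using L f by (auto simp: linear_functional_on_def dest!: bspec[where x = f] spec[where x = "-1"])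
      moreover have "L1 (\<lambda>x. - f x) \<le> - m f" "L1 f \<le> m f"
        using L1 f subspace_minus[OF f] neg[OF f] unfolding dominated_on_def by force+
      ultimately show "L1 f = m f" by simp
    qed
  qed
  moreover have "m f0 = p f0"
  proof (rule antisym)
    show "m f0 \<le> p f0" using dom f0 by (simp add: dominated_on_def)
    have sp': "sublinear_on V p'" using p' by (simp add: face_functional_def)
    have "m (\<lambda>x. - f0 x) \<le> p1 (\<lambda>x. - f0 x)"
      using mA subspace_minus[OF f0] by (simp add: A_def dominated_on_def)
    also have "\<dots> \<le> - p' f0" unfolding p1_def by (rule tilt_minus[OF sp' f0])
    finally show "p f0 \<le> m f0" using neg[OF f0] p'V[OF f0] by simp
  qed
  ultimately show thesis by (rule that)
qed

end

section \<open>Means on continuous functions and the Riesz representation theorem\<close>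

text \<open>Functions live on the whole type, but continuity and positivity are tested on
  \<open>X\<close> only. Hence the value of \<open>L\<close> at a function continuous on
  \<open>X\<close> depends only on its restriction to \<open>X\<close>.\<close>

definition mean_on :: "'a::metric_space set \<Rightarrow> (('a \<Rightarrow> real) \<Rightarrow> real) \<Rightarrow> bool" where
  "mean_on X L \<longleftrightarrow> linear_functional_on {f. continuous_on X f} L \<and>
     (\<forall>f. continuous_on X f \<longrightarrow> (\<forall>x\<in>X. 0 \<le> f x) \<longrightarrow> 0 \<le> L f) \<and> L (\<lambda>x. 1) = 1"

lemma function_subspace_continuous: "function_subspace {f :: 'a::metric_space \<Rightarrow> real. continuous_on X f}"
  by (auto simp: function_subspace_def intro!: continuous_intros)

text \<open>The distance to the complement works, except when the complement is empty:
  \<open>infdist\<close> to the empty set is \<open>0\<close> by convention, so that case takes a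
  constant.\<close>

lemma open_positivity_function:
  fixes W :: "'a::metric_space set"
  assumes "open W"
  obtains g :: "'a \<Rightarrow> real"
  where "continuous_on UNIV g" "\<And>x. 0 \<le> g x" "\<And>x. 0 < g x \<longleftrightarrow> x \<in> W"
proof (cases "- W = {}")
  case True
  then show ?thesis by (intro that[of "\<lambda>x. 1"]) auto
next
  case False
  have "0 < infdist x (- W) \<longleftrightarrow> x \<in> W" for x
    using in_closed_iff_infdist_zero[of "- W" x] assms False infdist_nonneg[of x "- W"]
    by (auto simp: open_closed less_le)
  then show ?thesis
    by (intro that[of "\<lambda>x. infdist x (- W)"]) (auto intro!: continuous_intros infdist_nonneg)
qed

text \<open>
  No condition on supports is imposed: cutting \<open>f\<close> to \<open>max 0 (f - e)\<close> makes its support compact in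
  \<open>U\<close> and lowers \<open>L f\<close> by at most \<open>e\<close>.
\<close>

definition open_content :: "'a::metric_space set \<Rightarrow> (('a \<Rightarrow> real) \<Rightarrow> real) \<Rightarrow> 'a set \<Rightarrow> ennreal" where
  "open_content X L U =
     (SUP f\<in>{f. continuous_on X f \<and> (\<forall>x\<in>X. 0 \<le> f x \<and> f x \<le> indicator U x)}. ennreal (L f))"

definition content_outer :: "'a::metric_space set \<Rightarrow> (('a \<Rightarrow> real) \<Rightarrow> real) \<Rightarrow> 'a set \<Rightarrow> ennreal" where
  "content_outer X L A = (INF U\<in>{U. openin (top_of_set X) U \<and> A \<subseteq> U}. open_content X L U)"

context
  fixes X :: "'a::metric_space set" and L :: "('a \<Rightarrow> real) \<Rightarrow> real"
  assumes mean: "mean_on X L"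
begin

lemma mean_add: "continuous_on X f \<Longrightarrow> continuous_on X g \<Longrightarrow> L (\<lambda>x. f x + g x) = L f + L g"
  and mean_scale: "continuous_on X f \<Longrightarrow> L (\<lambda>x. c * f x) = c * L f"
  and mean_nonneg: "continuous_on X f \<Longrightarrow> (\<And>x. x \<in> X \<Longrightarrow> 0 \<le> f x) \<Longrightarrow> 0 \<le> L f"
  and mean_one: "L (\<lambda>x. 1) = 1"
  using mean by (auto simp: mean_on_def linear_functional_on_def)

lemma mean_diff: "continuous_on X f \<Longrightarrow> continuous_on X g \<Longrightarrow> L (\<lambda>x. f x - g x) = L f - L g"
  using mean_add[of f "\<lambda>x. (-1) * g x"] mean_scale[of g "-1"]
  by (simp add: continuous_on_minus)

lemma mean_const: "L (\<lambda>x. c) = c"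
  using mean_scale[of "\<lambda>x. 1" c] mean_one by simp

lemma mean_mono:
  assumes "continuous_on X f" "continuous_on X g" "\<And>x. x \<in> X \<Longrightarrow> f x \<le> g x"
  shows "L f \<le> L g"
  using mean_nonneg[of "\<lambda>x. g x - f x"] mean_diff[OF assms(2,1)] assms
  by (simp add: continuous_on_diff)

lemma mean_sum:
  assumes "finite I" "\<And>i. i \<in> I \<Longrightarrow> continuous_on X (f i)"
  shows "L (\<lambda>x. \<Sum>i\<in>I. f i x) = (\<Sum>i\<in>I. L (f i))"
  using assms
proof (induction I rule: finite_induct)
  case empty
  then show ?case using mean_const[of 0] by simp
next
  case (insert i I)
  then show ?case by (simp add: mean_add continuous_on_sum)
qed

lemma mean_le_open_content:
  assumes "continuous_on X f" "\<And>x. x \<in> X \<Longrightarrow> 0 \<le> f x" "\<And>x. x \<in> X \<Longrightarrow> f x \<le> indicator U x"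
  shows "ennreal (L f) \<le> open_content X L U"
  unfolding open_content_def using assms by (intro SUP_upper) auto

lemma open_content_mono: "U \<subseteq> V \<Longrightarrow> open_content X L U \<le> open_content X L V"
  unfolding open_content_def
  by (rule SUP_subset_mono) (auto simp: indicator_def subset_iff split: if_splits)

lemma open_content_empty: "open_content X L {} = 0"
proof -
  have "L f \<le> 0" if "continuous_on X f" "\<forall>x\<in>X. 0 \<le> f x \<and> f x \<le> indicator {} x" for f
    using mean_mono[of f "\<lambda>x. 0"] mean_const[of 0] that by simp
  then have "open_content X L {} \<le> 0"
    unfolding open_content_def by (intro SUP_least) (auto simp: ennreal_eq_0_iff)
  then show ?thesis by simp
qed

lemma open_content_space: "open_content X L X = 1"
proof (rule antisym)
  show "open_content X L X \<le> 1"
    unfolding open_content_def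
    using mean_mono[of _ "\<lambda>x. 1"] mean_one by (intro SUP_least) auto
  show "1 \<le> open_content X L X"
    using mean_le_open_content[of "\<lambda>x. 1" X] mean_one by simp
qed

lemma mean_le_cut:
  assumes "continuous_on X f" "0 \<le> e"
  shows "L f \<le> e + L (\<lambda>x. max 0 (f x - e))"
proof -
  have "L f \<le> L (\<lambda>x. e + max 0 (f x - e))"
    using assms by (intro mean_mono) (auto intro!: continuous_intros)
  also have "\<dots> = L (\<lambda>x. e) + L (\<lambda>x. max 0 (f x - e))"
    using assms by (intro mean_add) (auto intro!: continuous_intros)
  finally show ?thesis by (simp add: mean_const)
qed

text \<open>A partition of unity subordinate to the \<open>W i\<close> on the compact set where
  \<open>e \<le> f\<close> splits the cut function \<open>max 0 (f - e)\<close> into pieces, each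
  below the indicator of one \<open>W i\<close>. The cut itself costs \<open>e\<close>.\<close>

lemma open_content_finite_subadditive:
  assumes X: "compact X" and D: "finite D" and W: "\<And>i. i \<in> D \<Longrightarrow> open (W i)"
    and f: "continuous_on X f" "\<And>x. x \<in> X \<Longrightarrow> 0 \<le> f x" "\<And>x. x \<in> X \<Longrightarrow> f x \<le> 1" and e: "0 < e"
    and cover: "{x\<in>X. e \<le> f x} \<subseteq> (\<Union>i\<in>D. W i)"
  shows "ennreal (L f) \<le> (\<Sum>i\<in>D. open_content X L (X \<inter> W i)) + ennreal e"
proof (cases "{x\<in>X. e \<le> f x} = {}")
  case True
  then have "L f \<le> L (\<lambda>x. e)" using f by (intro mean_mono) force+
  then have "ennreal (L f) \<le> ennreal e" by (simp add: mean_const ennreal_leI)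
  then show ?thesis by (rule order_trans) simp
next
  case False
  have "\<exists>g :: 'a \<Rightarrow> real. continuous_on UNIV g \<and> (\<forall>x. 0 \<le> g x) \<and> (\<forall>x. 0 < g x \<longleftrightarrow> x \<in> W i)"
    if "i \<in> D" for i
    using open_positivity_function[OF W[OF that]] by metis
  then obtain g :: "_ \<Rightarrow> 'a \<Rightarrow> real" where g: "\<And>i. i \<in> D \<Longrightarrow> continuous_on UNIV (g i)"
    "\<And>i x. i \<in> D \<Longrightarrow> 0 \<le> g i x" "\<And>i x. i \<in> D \<Longrightarrow> 0 < g i x \<longleftrightarrow> x \<in> W i"
    by metis
  have gX: "continuous_on X (g i)" if "i \<in> D" for i
    using g(1)[OF that] continuous_on_subset by blast
  define s where "s x = (\<Sum>i\<in>D. g i x)" for x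
  have s: "continuous_on X s" unfolding s_def using gX by (intro continuous_on_sum)
  have "closedin (top_of_set X) {x\<in>X. e \<le> f x}"
    using continuous_closedin_preimage[OF f(1), of "{e..}"] by (simp add: vimage_def Int_def)
  with X have "compact {x\<in>X. e \<le> f x}" by (rule closedin_compact)
  moreover have "continuous_on {x\<in>X. e \<le> f x} s" by (rule continuous_on_subset[OF s]) auto
  ultimately obtain y where y: "y \<in> X" "e \<le> f y" "\<And>x. x \<in> X \<Longrightarrow> e \<le> f x \<Longrightarrow> s y \<le> s x"
    using continuous_attains_inf[OF _ False, of s] by auto
  obtain i where i: "i \<in> D" "y \<in> W i" using y cover by auto
  have "g i y \<le> s y" unfolding s_def using D g(2) i by (intro member_le_sum) auto
  moreover have "0 < g i y" using g(3)[OF i(1)] i(2) by simp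
  ultimately have sy: "0 < s y" by simp
  \<comment> \<open>The number \<open>s y > 0\<close> is the minimum of \<open>s\<close> on the set
    where \<open>e \<le> f\<close>. The \<open>max\<close> leaves \<open>s\<close> unchanged there
    and keeps the denominator positive elsewhere, where the cut factor vanishes anyway.\<close>
  define h where "h i x = g i x / max (s y) (s x) * max 0 (f x - e)" for i x
  have h: "continuous_on X (h i)" if "i \<in> D" for i
    unfolding h_def using gX[OF that] s f sy by (intro continuous_intros) auto
  have h0: "0 \<le> h i x" if "i \<in> D" for i x
    unfolding h_def using g(2)[OF that] sy by (intro mult_nonneg_nonneg divide_nonneg_nonneg) auto
  have hW: "h i x \<le> indicator (X \<inter> W i) x" if "i \<in> D" "x \<in> X" for i x
  proof (cases "x \<in> W i")
    case True
    have "g i x \<le> s x" unfolding s_def using D g(2) that by (intro member_le_sum) auto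
    then have "g i x / max (s y) (s x) \<le> 1" using sy by (simp add: divide_le_eq max_def)
    moreover have "max 0 (f x - e) \<le> 1" using f(3)[OF that(2)] e by simp
    ultimately have "h i x \<le> 1"
      unfolding h_def using g(2)[OF that(1), of x] sy by (intro mult_le_one) auto
    then show ?thesis using True that by simp
  next
    case False
    then have "g i x = 0" using g(2,3)[OF that(1), of x] by (simp add: less_le)
    then show ?thesis by (simp add: h_def)
  qed
  have sum_h: "(\<Sum>i\<in>D. h i x) = max 0 (f x - e)" if "x \<in> X" for x
  proof (cases "e \<le> f x")
    case True
    then have "max (s y) (s x) = s x" "0 < s x" using y(3)[OF that] sy by auto
    then show ?thesis
      unfolding h_def by (simp add: sum_distrib_right[symmetric] sum_divide_distrib[symmetric] s_def[symmetric])
  qed (simp add: h_def)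
  have "L f \<le> e + L (\<lambda>x. max 0 (f x - e))" using f e by (intro mean_le_cut) auto
  also have "L (\<lambda>x. max 0 (f x - e)) \<le> L (\<lambda>x. \<Sum>i\<in>D. h i x)"
    using sum_h f h by (intro mean_mono) (auto intro!: continuous_intros)
  also have "\<dots> = (\<Sum>i\<in>D. L (h i))" using D h by (rule mean_sum)
  finally have "ennreal (L f) \<le> ennreal (e + (\<Sum>i\<in>D. L (h i)))" by (rule ennreal_leI) simp
  also have "\<dots> = ennreal e + (\<Sum>i\<in>D. ennreal (L (h i)))"
    using e mean_nonneg[OF h] h0 by (simp add: sum_nonneg sum_ennreal)
  also have "\<dots> \<le> ennreal e + (\<Sum>i\<in>D. open_content X L (X \<inter> W i))"
    using h h0 hW by (intro add_left_mono sum_mono mean_le_open_content) auto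
  finally show ?thesis by (simp add: add.commute)
qed

text \<open>For a competitor \<open>f\<close> the set where \<open>e \<le> f\<close> is compact and
  lies in the union, so finitely many of the open sets cover it.\<close>

lemma open_content_countably_subadditive:
  assumes X: "compact X" and U: "\<And>i :: nat. openin (top_of_set X) (U i)"
  shows "open_content X L (\<Union>i. U i) \<le> (\<Sum>i. open_content X L (U i))"
  unfolding open_content_def[of X L "\<Union>i. U i"]
proof (rule SUP_least)
  fix f :: "'a \<Rightarrow> real"
  assume "f \<in> {f. continuous_on X f \<and> (\<forall>x\<in>X. 0 \<le> f x \<and> f x \<le> indicator (\<Union>i. U i) x)}"
  then have f: "continuous_on X f" "\<And>x. x \<in> X \<Longrightarrow> 0 \<le> f x"
    "\<And>x. x \<in> X \<Longrightarrow> f x \<le> indicator (\<Union>i. U i) x" by auto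
  obtain W where W: "\<And>i. open (W i)" "\<And>i. U i = X \<inter> W i"
    using U unfolding openin_open by metis
  have f1: "f x \<le> 1" if "x \<in> X" for x
    by (rule order_trans[OF f(3)[OF that]]) simp
  show "ennreal (L f) \<le> (\<Sum>i. open_content X L (U i))"
  proof (rule ennreal_le_epsilon)
    fix e :: real assume e: "0 < e"
    have "closedin (top_of_set X) {x\<in>X. e \<le> f x}"
      using continuous_closedin_preimage[OF f(1), of "{e..}"] by (simp add: vimage_def Int_def)
    with X have cpt: "compact {x\<in>X. e \<le> f x}" by (rule closedin_compact)
    have "{x\<in>X. e \<le> f x} \<subseteq> (\<Union>i. W i)"
    proof
      fix x assume x: "x \<in> {x\<in>X. e \<le> f x}"
      then have "(0::real) < indicator (\<Union>i. U i) x" using e f(3)[of x] by auto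
      then show "x \<in> (\<Union>i. W i)" using W by (auto simp: indicator_def split: if_splits)
    qed
    then obtain D where D: "finite D" "{x\<in>X. e \<le> f x} \<subseteq> (\<Union>i\<in>D. W i)"
      by (rule compactE_image[OF cpt W(1)])
    have "ennreal (L f) \<le> (\<Sum>i\<in>D. open_content X L (X \<inter> W i)) + ennreal e"
      using X D W f f1 e by (intro open_content_finite_subadditive) auto
    also have "(\<Sum>i\<in>D. open_content X L (X \<inter> W i)) \<le> (\<Sum>i. open_content X L (U i))"
      unfolding W(2)[symmetric] using D by (intro sum_le_suminf) auto
    finally show "ennreal (L f) \<le> (\<Sum>i. open_content X L (U i)) + ennreal e"
      by (simp add: add_right_mono)
  qed
qed

lemma content_outer_open: "openin (top_of_set X) U \<Longrightarrow> content_outer X L U = open_content X L U"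
  unfolding content_outer_def by (intro antisym INF_greatest INF_lower open_content_mono) auto

lemma content_outer_le_open:
  "openin (top_of_set X) U \<Longrightarrow> A \<subseteq> U \<Longrightarrow> content_outer X L A \<le> open_content X L U"
  unfolding content_outer_def by (intro INF_lower) auto

lemma content_outer_mono: "A \<subseteq> B \<Longrightarrow> content_outer X L A \<le> content_outer X L B"
  unfolding content_outer_def by (intro INF_superset_mono) auto

lemma content_outer_space: "content_outer X L X = 1"
  by (simp add: content_outer_open open_content_space)

lemma outer_measure_space_content_outer:
  assumes X: "compact X"
  shows "outer_measure_space (Pow X) (content_outer X L)"
  unfolding outer_measure_space_def
proof (intro conjI)
  show "positive (Pow X) (content_outer X L)"
    by (simp add: positive_def content_outer_open open_content_empty)
  show "increasing (Pow X) (content_outer X L)"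
    by (simp add: increasing_def content_outer_mono)
  show "countably_subadditive (Pow X) (content_outer X L)"
    unfolding countably_subadditive_def
  proof (intro allI impI)
    fix A :: "nat \<Rightarrow> 'a set" assume A: "range A \<subseteq> Pow X"
    show "content_outer X L (\<Union>i. A i) \<le> (\<Sum>n. content_outer X L (A n))"
    proof (rule ennreal_le_epsilon)
      fix e :: real assume e: "0 < e"
      have "\<exists>U. openin (top_of_set X) U \<and> A n \<subseteq> U \<and>
          open_content X L U < content_outer X L (A n) + ennreal (e * (1/2)^Suc n)" for n
      proof -
        have "content_outer X L (A n) \<le> 1"
          using content_outer_mono[of "A n" X] content_outer_space A by auto
        then have "content_outer X L (A n) < \<infinity>" by (rule le_less_trans) simp
        then have "content_outer X L (A n) < content_outer X L (A n) + ennreal (e * (1/2)^Suc n)"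
          using e by (simp add: ennreal_zero_less_mult_iff)
        then show ?thesis unfolding content_outer_def[of X L "A n"] INF_less_iff by auto
      qed
      then obtain U where U: "\<And>n. openin (top_of_set X) (U n)" "\<And>n. A n \<subseteq> U n"
        "\<And>n. open_content X L (U n) < content_outer X L (A n) + ennreal (e * (1/2)^Suc n)"
        by metis
      have "content_outer X L (\<Union>i. A i) \<le> open_content X L (\<Union>i. U i)"
        using U by (intro content_outer_le_open openin_Union) auto
      also have "\<dots> \<le> (\<Sum>i. open_content X L (U i))"
        by (rule open_content_countably_subadditive[OF X U(1)])
      also have "\<dots> \<le> (\<Sum>i. content_outer X L (A i) + ennreal (e * (1/2)^Suc i))"
        using U(3) by (intro suminf_le) (auto intro: less_imp_le)
      also have "\<dots> = (\<Sum>i. content_outer X L (A i)) + (\<Sum>i. ennreal e * ennreal ((1/2)^Suc i))"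
        using e by (subst suminf_add[symmetric])
          (auto simp del: ennreal_suminf_cmult simp add: ennreal_mult[symmetric])
      also have "(\<Sum>i. ennreal e * ennreal ((1/2)^Suc i)) = ennreal e"
        unfolding ennreal_suminf_cmult
        by (subst suminf_ennreal_eq[OF zero_le_power power_half_series]) auto
      finally show "content_outer X L (\<Union>i. A i) \<le> (\<Sum>n. content_outer X L (A n)) + ennreal e" .
    qed
  qed
qed

text \<open>This is the nontrivial half of Caratheodory's criterion for open sets. A competitor
  \<open>f\<close> for \<open>V \<inter> U\<close>, cut at height \<open>e\<close>, lives on the
  closed set \<open>K\<close> where \<open>e \<le> f\<close>. It can be added to any competitor for
  \<open>V - K\<close> without exceeding the indicator of \<open>V\<close>, and \<open>V - K\<close>
  contains \<open>A - U\<close>.\<close>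

lemma content_outer_split_ge:
  assumes U: "openin (top_of_set X) U" and A: "A \<subseteq> X"
  shows "content_outer X L (A \<inter> U) + content_outer X L (A - U) \<le> content_outer X L A"
  unfolding content_outer_def[of X L A]
proof (rule INF_greatest)
  fix V assume "V \<in> {V. openin (top_of_set X) V \<and> A \<subseteq> V}"
  then have V: "openin (top_of_set X) V" "A \<subseteq> V" by auto
  have *: "ennreal (L f) + content_outer X L (A - U) \<le> open_content X L V"
    if f: "continuous_on X f" "\<And>x. x \<in> X \<Longrightarrow> 0 \<le> f x" "\<And>x. x \<in> X \<Longrightarrow> f x \<le> indicator (V \<inter> U) x" for f
  proof (rule ennreal_le_epsilon)
    fix e :: real assume e: "0 < e"
    define K where "K = {x\<in>X. e \<le> f x}"
    have KU: "K \<subseteq> V \<inter> U"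
    proof
      fix x assume x: "x \<in> K"
      then have "(0::real) < indicator (V \<inter> U) x" using e f(3)[of x] by (auto simp: K_def)
      then show "x \<in> V \<inter> U" by (auto simp: indicator_def split: if_splits)
    qed
    have "closedin (top_of_set X) K"
      using continuous_closedin_preimage[OF f(1), of "{e..}"] by (simp add: vimage_def Int_def K_def)
    then have VK: "openin (top_of_set X) (V - K)" using V by (intro openin_diff)
    have "ennreal (L (\<lambda>x. max 0 (f x - e))) + ennreal (L g) \<le> open_content X L V"
      if g: "continuous_on X g" "\<And>x. x \<in> X \<Longrightarrow> 0 \<le> g x" "\<And>x. x \<in> X \<Longrightarrow> g x \<le> indicator (V - K) x" for g
    proof -
      have c: "continuous_on X (\<lambda>x. max 0 (f x - e))" using f by (intro continuous_intros)
      have "ennreal (L (\<lambda>x. max 0 (f x - e))) + ennreal (L g) = ennreal (L (\<lambda>x. max 0 (f x - e) + g x))"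
        using c g mean_nonneg[OF c] mean_nonneg[OF g(1)] by (simp add: mean_add)
      also have "\<dots> \<le> open_content X L V"
      proof (rule mean_le_open_content)
        fix x assume x: "x \<in> X"
        show "max 0 (f x - e) + g x \<le> indicator V x"
          using f(2,3)[OF x] g(2,3)[OF x] x KU e
          by (cases "x \<in> K") (auto simp: K_def indicator_def max_def split: if_splits)
      qed (use c g in \<open>auto intro!: continuous_intros\<close>)
      finally show ?thesis .
    qed
    then have sum: "ennreal (L (\<lambda>x. max 0 (f x - e))) + open_content X L (V - K) \<le> open_content X L V"
      unfolding open_content_def[of X L "V - K"]
      by (subst ennreal_SUP_add_right) (auto intro!: SUP_least exI[of _ "\<lambda>x. 0"])
    have "content_outer X L (A - U) \<le> open_content X L (V - K)"
      using VK V(2) KU by (intro content_outer_le_open) auto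
    moreover have "ennreal (L f) \<le> ennreal (L (\<lambda>x. max 0 (f x - e))) + ennreal e"
    proof -
      have "0 \<le> L (\<lambda>x. max 0 (f x - e))" using f by (intro mean_nonneg) (auto intro!: continuous_intros)
      then show ?thesis using mean_le_cut[OF f(1), of e] e
        by (simp add: ennreal_plus[symmetric] add.commute ennreal_leI del: ennreal_plus)
    qed
    ultimately have "ennreal (L f) + content_outer X L (A - U) \<le>
        (ennreal (L (\<lambda>x. max 0 (f x - e))) + ennreal e) + open_content X L (V - K)"
      by (intro add_mono)
    also have "\<dots> = (ennreal (L (\<lambda>x. max 0 (f x - e))) + open_content X L (V - K)) + ennreal e"
      by (simp add: ac_simps)
    also have "\<dots> \<le> open_content X L V + ennreal e" using sum by (rule add_right_mono)
    finally show "ennreal (L f) + content_outer X L (A - U) \<le> open_content X L V + ennreal e" .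
  qed
  have "content_outer X L (A \<inter> U) + content_outer X L (A - U) \<le>
      open_content X L (V \<inter> U) + content_outer X L (A - U)"
    using U V by (intro add_right_mono content_outer_le_open) auto
  also have "\<dots> \<le> open_content X L V"
    unfolding open_content_def[of X L "V \<inter> U"]
    using * by (subst ennreal_SUP_add_left[symmetric]) (auto intro!: SUP_least exI[of _ "\<lambda>x. 0"])
  finally show "content_outer X L (A \<inter> U) + content_outer X L (A - U) \<le> open_content X L V" .
qed

end

section \<open>Borel sets of \<open>X\<close> and measures determined by continuous
  integrals\<close>

lemma sets_restrict_borel_sigma:
  "sets (restrict_space borel X) = sigma_sets X {U. openin (top_of_set X) U}"
proof -
  have "{U. openin (top_of_set X) U} = {(\<lambda>x. x) -` S \<inter> X |S. S \<in> {S. open S}}"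
    by (auto simp: openin_open)
  moreover have "sets (restrict_space borel X) = {(\<lambda>x. x) -` S \<inter> X |S. S \<in> sigma_sets UNIV {S. open S}}"
    by (auto simp: sets_restrict_space borel_def)
  ultimately show ?thesis
    using sigma_sets_vimage_commute[of "\<lambda>x. x" X UNIV "{S. open S}"] by simp
qed

lemma openin_sets:
  "sets M = sets (restrict_space borel X) \<Longrightarrow> openin (top_of_set X) U \<Longrightarrow> U \<in> sets M"
  by (auto simp: sets_restrict_borel_sigma)

lemma space_borel_on: "sets M = sets (restrict_space borel X) \<Longrightarrow> space M = X"
  using sets_eq_imp_space_eq[of M "restrict_space borel X"] by (simp add: space_restrict_space)

lemma continuous_measurable:
  fixes f :: "'a::metric_space \<Rightarrow> 'b::metric_space"
  assumes "sets M = sets (restrict_space borel X)" "continuous_on X f"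
  shows "f \<in> borel_measurable M"
  using borel_measurable_continuous_on_restrict[OF assms(2)] measurable_cong_sets[OF assms(1) refl] by blast

lemma continuous_integrable:
  fixes f :: "'a::metric_space \<Rightarrow> real"
  assumes "sets M = sets (restrict_space borel X)" "finite_measure M" "compact X" "continuous_on X f"
  shows "integrable M f"
proof -
  have "bounded (f ` X)" using assms by (intro compact_imp_bounded compact_continuous_image)
  then obtain B where B: "\<And>x. x \<in> X \<Longrightarrow> norm (f x) \<le> B" by (auto simp: bounded_iff)
  show ?thesis
    using B continuous_measurable[OF assms(1,4)] space_borel_on[OF assms(1)]
    by (intro finite_measure.integrable_const_bound[OF assms(2), of _ B]) auto
qed

text \<open>The continuous functions \<open>min 1 (n * g)\<close> converge to the indicator of the
  open set where \<open>g\<close> is positive. Dominated convergence gives equality on open sets,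
  which generate the Borel sets and are closed under intersection.\<close>

lemma continuous_integrals_determine_measure:
  fixes X :: "'a::metric_space set"
  assumes X: "compact X"
    and M: "sets M = sets (restrict_space borel X)" "finite_measure M"
    and N: "sets N = sets (restrict_space borel X)" "finite_measure N"
    and eq: "\<And>f :: 'a \<Rightarrow> real. continuous_on X f \<Longrightarrow> (\<integral>x. f x \<partial>M) = (\<integral>x. f x \<partial>N)"
  shows "M = N"
proof -
  interpret M: finite_measure M by (rule M)
  interpret N: finite_measure N by (rule N)
  have E: "emeasure M U = emeasure N U" if U: "openin (top_of_set X) U" for U
  proof -
    obtain W where W: "open W" "U = X \<inter> W" using U by (auto simp: openin_open)
    obtain g :: "'a \<Rightarrow> real" where g: "continuous_on UNIV g" "\<And>x. 0 \<le> g x" "\<And>x. 0 < g x \<longleftrightarrow> x \<in> W"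
      using open_positivity_function[OF W(1)] by metis
    have gX: "continuous_on X g" using g(1) continuous_on_subset by blast
    have lim: "(\<lambda>n. \<integral>x. min 1 (real n * g x) \<partial>Q) \<longlonglongrightarrow> measure Q U"
      if Q: "sets Q = sets (restrict_space borel X)" "finite_measure Q" for Q
    proof -
      interpret Q: finite_measure Q by (rule Q)
      have UQ: "U \<in> sets Q" by (rule openin_sets[OF Q(1) U])
      have "(\<lambda>n. \<integral>x. min 1 (real n * g x) \<partial>Q) \<longlonglongrightarrow> (\<integral>x. indicator U x \<partial>Q)"
      proof (rule integral_dominated_convergence[where w = "\<lambda>x. 1"])
        show "AE x in Q. (\<lambda>n. min 1 (real n * g x)) \<longlonglongrightarrow> indicator U x"
        proof (rule AE_I2)
          fix x assume "x \<in> space Q"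
          then have x: "x \<in> X" using space_borel_on[OF Q(1)] by simp
          show "(\<lambda>n. min 1 (real n * g x)) \<longlonglongrightarrow> indicator U x"
          proof (cases "x \<in> W")
            case True
            then have gx: "0 < g x" using g by simp
            have "eventually (\<lambda>n. 1 / g x \<le> real n) sequentially"
              using filterlim_real_sequentially by (simp add: filterlim_at_top)
            then have "eventually (\<lambda>n. min 1 (real n * g x) = indicator U x) sequentially"
              using gx True x W by (auto simp: field_simps elim!: eventually_mono)
            then show ?thesis by (rule tendsto_eventually)
          next
            case False
            then have "g x = 0" using g(2,3)[of x] by (simp add: less_le)
            then show ?thesis using False W by simp
          qed
        qed
        show "AE x in Q. norm (min 1 (real n * g x)) \<le> 1" for n
          using g(2) by (auto simp: abs_le_iff)
        show "(\<lambda>x. min 1 (real n * g x)) \<in> borel_measurable Q" for n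
          using gX by (intro continuous_measurable[OF Q(1)] continuous_intros)
      qed (use UQ in auto)
      then show ?thesis using UQ by simp
    qed
    have "(\<integral>x. min 1 (real n * g x) \<partial>M) = (\<integral>x. min 1 (real n * g x) \<partial>N)" for n
      using gX by (intro eq continuous_intros)
    then have "measure M U = measure N U"
      using lim[OF M] lim[OF N] by (simp add: LIMSEQ_unique)
    then show ?thesis by (simp add: M.emeasure_eq_measure N.emeasure_eq_measure)
  qed
  show ?thesis
  proof (rule measure_eqI_generator_eq[where \<Omega> = X and E = "{U. openin (top_of_set X) U}" and A = "\<lambda>_. X"])
    show "Int_stable {U. openin (top_of_set X) U}" by (auto simp: Int_stable_def)
    show "{U. openin (top_of_set X) U} \<subseteq> Pow X" by (auto dest: openin_imp_subset)
  qed (use E M N in \<open>auto simp: sets_restrict_borel_sigma\<close>)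
qed

text \<open>The sets satisfying Caratheodory's criterion form a sigma-algebra containing the open
  sets of \<open>X\<close>, hence the Borel sets; the measure is restricted to these.\<close>

lemma measure_space_content_outer:
  assumes X: "compact X" and mean: "mean_on X L"
  shows "measure_space X (sets (restrict_space borel X)) (content_outer X L)"
proof -
  define \<Lambda> where "\<Lambda> = lambda_system X (Pow X) (content_outer X L)"
  have ms: "measure_space X \<Lambda> (content_outer X L)"
    unfolding \<Lambda>_def
    by (rule sigma_algebra.caratheodory_lemma[OF sigma_algebra_Pow outer_measure_space_content_outer[OF mean X]])
  then have sa: "sigma_algebra X \<Lambda>" by (simp add: measure_space_def)
  have "U \<in> \<Lambda>" if U: "openin (top_of_set X) U" for U
    unfolding \<Lambda>_def lambda_system_def
  proof (intro CollectI conjI ballI)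
    show "U \<in> Pow X" using openin_imp_subset[OF U] by simp
    fix A assume "A \<in> Pow X"
    then have A: "A \<subseteq> X" by simp
    have eq: "U \<inter> A = A \<inter> U" "(X - U) \<inter> A = A - U" using A by auto
    have "subadditive (Pow X) (content_outer X L)"
      using outer_measure_space_content_outer[OF mean X]
      by (intro ring_of_sets.countably_subadditive_subadditive[OF _ ])
        (auto simp: outer_measure_space_def intro: algebra.axioms algebra_Pow)
    then have "content_outer X L ((A \<inter> U) \<union> (A - U)) \<le> content_outer X L (A \<inter> U) + content_outer X L (A - U)"
      using A by (intro subadditiveD[of "Pow X"]) auto
    moreover have "(A \<inter> U) \<union> (A - U) = A" by auto
    ultimately show "content_outer X L (U \<inter> A) + content_outer X L ((X - U) \<inter> A) = content_outer X L A"
      unfolding eq using content_outer_split_ge[OF mean U A] by (intro antisym) auto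
  qed
  then have sub: "sets (restrict_space borel X) \<subseteq> \<Lambda>"
    unfolding sets_restrict_borel_sigma by (intro sigma_algebra.sigma_sets_subset[OF sa]) auto
  have "sigma_algebra X (sets (restrict_space borel X))"
    unfolding sets_restrict_borel_sigma by (intro sigma_algebra_sigma_sets) (auto dest: openin_imp_subset)
  moreover have "countably_additive (sets (restrict_space borel X)) (content_outer X L)"
    using ms sub unfolding measure_space_def countably_additive_def by (metis subset_trans subsetD)
  ultimately show ?thesis
    using ms by (auto simp: measure_space_def positive_def)
qed

theorem riesz_mean_representation:
  fixes X :: "'a::metric_space set"
  assumes X: "compact X" and mean: "mean_on X L"
  obtains M where "regular_borel_prob X M" "\<And>f. continuous_on X f \<Longrightarrow> (\<integral>x. f x \<partial>M) = L f"
proof -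
  let ?B = "sets (restrict_space borel X)"
  define M where "M = measure_of X ?B (content_outer X L)"
  have ms: "measure_space X ?B (content_outer X L)" by (rule measure_space_content_outer[OF X mean])
  then have sa: "sigma_algebra X ?B" by (simp add: measure_space_def)
  have sets_M: "sets M = ?B" unfolding M_def by (rule sigma_algebra.sets_measure_of_eq[OF sa])
  have space_M: "space M = X" by (rule space_borel_on[OF sets_M])
  have M: "emeasure M A = content_outer X L A" if "A \<in> ?B" for A
    unfolding M_def using ms that by (intro emeasure_measure_of_sigma) (auto simp: measure_space_def)
  have M_open: "emeasure M U = open_content X L U" if "openin (top_of_set X) U" for U
    using M[of U] openin_sets[OF sets_M that] content_outer_open[OF mean that] sets_M by simp
  have XB: "X \<in> ?B" using space_M sets.top[of M] sets_M by simp
  interpret prob_space M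
    by (intro prob_spaceI) (simp add: space_M M[OF XB] content_outer_space[OF mean])
  have outer: "emeasure M A = (INF U\<in>{U. openin (top_of_set X) U \<and> A \<subseteq> U}. emeasure M U)" if "A \<in> ?B" for A
    unfolding M[OF that] content_outer_def by (intro INF_cong) (auto simp: M_open)
  have inner: "emeasure M A = (SUP K\<in>{K. compact K \<and> K \<subseteq> A}. emeasure M K)" if A: "A \<in> ?B" for A
  \<comment> \<open>Inner regularity is outer regularity of the complement: if \<open>U\<close> is
    open around \<open>X - A\<close>, then \<open>X - U\<close> is compact and contained in
    \<open>A\<close>.\<close>
  proof (rule antisym)
    have AM: "A \<in> sets M" and AX: "A \<subseteq> X" using A sets_M sets.sets_into_space[of A M] space_M by auto
    show "emeasure M A \<le> (SUP K\<in>{K. compact K \<and> K \<subseteq> A}. emeasure M K)"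
    proof (rule ennreal_le_epsilon)
      fix e :: real assume e: "0 < e"
      have cA: "X - A \<in> ?B" using AM space_M sets_M sets.compl_sets[of A M] by simp
      obtain U where U: "openin (top_of_set X) U" "X - A \<subseteq> U" "emeasure M U < emeasure M (X - A) + e"
        using INF_approx_ennreal[OF e outer[OF cA]] by auto
      have UM: "U \<in> sets M" by (rule openin_sets[OF sets_M U(1)])
      have "compact (X - U)" using U(1) by (intro closedin_compact[OF X] closedin_diff) auto
      then have "emeasure M (X - U) \<le> (SUP K\<in>{K. compact K \<and> K \<subseteq> A}. emeasure M K)"
        using U(2) by (intro SUP_upper) auto
      moreover have "measure M U < measure M (X - A) + e"
        using U(3) e by (simp add: emeasure_eq_measure ennreal_plus[symmetric] ennreal_less_iff del: ennreal_plus)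
      then have "measure M A \<le> measure M (X - U) + e"
        using finite_measure_compl[OF AM] finite_measure_compl[OF UM] space_M prob_space by simp
      then have "emeasure M A \<le> emeasure M (X - U) + e"
        using e by (simp add: emeasure_eq_measure ennreal_plus[symmetric] del: ennreal_plus)
      ultimately show "emeasure M A \<le> (SUP K\<in>{K. compact K \<and> K \<subseteq> A}. emeasure M K) + e"
        by (meson add_right_mono order_trans)
    qed
    show "(SUP K\<in>{K. compact K \<and> K \<subseteq> A}. emeasure M K) \<le> emeasure M A"
      using AM by (intro SUP_least emeasure_mono) auto
  qed
  have reg: "regular_borel_prob X M"
    unfolding regular_borel_prob_def regular_measure_on_def
    using sets_M inner outer prob_space_axioms by blast
  have integrable: "integrable M f" if "continuous_on X f" for f :: "'a \<Rightarrow> real"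
    by (rule continuous_integrable[OF sets_M finite_measure_axioms X that])
  \<comment> \<open>One inequality suffices: apply it to \<open>1 - f\<close> for the other.\<close>
  have le: "L f \<le> (\<integral>x. f x \<partial>M)"
    if f: "continuous_on X f" and f01: "\<And>x. x \<in> X \<Longrightarrow> 0 \<le> f x" "\<And>x. x \<in> X \<Longrightarrow> f x \<le> 1" for f
  proof (rule field_le_epsilon)
    fix e :: real assume "0 < e"
    then obtain n where n: "0 < n" "1 / real n < e" using nat_approx_posE by (metis zero_less_Suc)
    \<comment> \<open>The graph of \<open>f\<close> is cut into \<open>n\<close> horizontal layers
      of height \<open>1/n\<close>. Scaled by \<open>n\<close>, layer \<open>k\<close> is a
      competitor for the open set \<open>W k\<close>, so its mean is at most the measure of
      \<open>W k\<close> divided by \<open>n\<close>.\<close>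
    define slice where "slice k x = min (f x) (real (Suc k) / n) - min (f x) (real k / n)" for k x
    have slice: "continuous_on X (slice k)" for k
      unfolding slice_def using f n by (intro continuous_intros) auto
    define W where "W k = {x\<in>X. real k / n < f x}" for k
    have W: "openin (top_of_set X) (W k)" for k
      using continuous_openin_preimage_gen[OF f, of "{real k / n<..}"]
      by (simp add: vimage_def Int_def W_def)
    have WM: "W k \<in> sets M" for k by (rule openin_sets[OF sets_M W])
    have int: "integrable M (\<lambda>x. indicator (W k) x / real n :: real)" for k
      using WM by (intro integrable_divide integrable_real_indicator) (auto simp: emeasure_eq_measure)
    have sum: "(\<Sum>k<n. slice k x) = f x" if "x \<in> X" for x
      unfolding slice_def sum_lessThan_telescope[of "\<lambda>k. min (f x) (real k / n)"]
      using f01[OF that] n by simp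
    have step: "real n * L (slice k) \<le> measure M (W k)" for k
    proof -
      have "ennreal (L (\<lambda>x. real n * slice k x)) \<le> open_content X L (W k)"
      proof (rule mean_le_open_content[OF mean])
        show "continuous_on X (\<lambda>x. real n * slice k x)" using slice by (intro continuous_intros)
        fix x assume x: "x \<in> X"
        have kn: "real k / n \<le> real (Suc k) / n" by (simp add: divide_right_mono)
        have "real (Suc k) / n - real k / n = 1 / n" by (simp add: diff_divide_distrib[symmetric])
        then have "slice k x \<le> 1 / n" using kn unfolding slice_def by auto
        then have 1: "real n * slice k x \<le> 1" using n by (simp add: field_simps)
        show "0 \<le> real n * slice k x" using kn unfolding slice_def by (intro mult_nonneg_nonneg) auto
        show "real n * slice k x \<le> indicator (W k) x"
        proof (cases "x \<in> W k")
          case False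
          then have "slice k x = 0" using x kn unfolding slice_def W_def by auto
          then show ?thesis by simp
        qed (use 1 in simp)
      qed
      then show ?thesis
        by (simp add: M_open[OF W, symmetric] emeasure_eq_measure mean_scale[OF mean slice])
    qed
    have "L f \<le> L (\<lambda>x. \<Sum>k<n. slice k x)"
      using sum f slice by (intro mean_mono[OF mean]) (auto intro!: continuous_intros)
    also have "\<dots> = (\<Sum>k<n. L (slice k))" using slice by (intro mean_sum[OF mean]) auto
    also have "\<dots> \<le> (\<Sum>k<n. measure M (W k) / n)"
      using step n by (intro sum_mono) (simp add: field_simps)
    also have "\<dots> = (\<integral>x. (\<Sum>k<n. indicator (W k) x / n) \<partial>M)"
      using WM int by (subst Bochner_Integration.integral_sum) auto
    also have "\<dots> \<le> (\<integral>x. f x + 1 / n \<partial>M)"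
    proof (rule integral_mono)
      show "integrable M (\<lambda>x. \<Sum>k<n. indicator (W k) x / real n)"
        using int by (intro Bochner_Integration.integrable_sum) auto
      show "integrable M (\<lambda>x. f x + 1 / real n)" using integrable[OF f] by simp
      fix x assume "x \<in> space M"
      then have x: "x \<in> X" using space_M by simp
      have "(\<Sum>k<n. indicator (W k) x :: real) = real (card {k\<in>{..<n}. x \<in> W k})"
        by (simp add: indicator_def sum.If_cases Int_def)
      \<comment> \<open>The point lies in \<open>W k\<close> only for \<open>k < n * f x\<close>.
        The rounding error of at most one set is the \<open>1/n\<close> in the integral
        bound.\<close>
      also have "card {k\<in>{..<n}. x \<in> W k} \<le> card {..<nat \<lceil>n * f x\<rceil>}"
      proof (intro card_mono subsetI)
        fix k assume "k \<in> {k\<in>{..<n}. x \<in> W k}"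
        then have "real k < n * f x" using n by (simp add: W_def field_simps)
        then show "k \<in> {..<nat \<lceil>n * f x\<rceil>}" by (simp add: zless_nat_eq_int_zless less_ceiling_iff)
      qed simp
      also have "real (card {..<nat \<lceil>n * f x\<rceil>}) \<le> n * f x + 1"
        using f01(1)[OF x] by (simp add: of_nat_nat)
      finally have "(\<Sum>k<n. indicator (W k) x :: real) \<le> n * f x + 1" by simp
      then show "(\<Sum>k<n. indicator (W k) x / real n) \<le> f x + 1 / real n"
        using n by (simp add: sum_divide_distrib[symmetric] field_simps)
    qed
    also have "\<dots> = (\<integral>x. f x \<partial>M) + 1 / n" using integrable[OF f] by (simp add: prob_space)
    finally show "L f \<le> (\<integral>x. f x \<partial>M) + e" using n by simp
  qed
  have eq01: "(\<integral>x. f x \<partial>M) = L f"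
    if f: "continuous_on X f" and f01: "\<And>x. x \<in> X \<Longrightarrow> 0 \<le> f x" "\<And>x. x \<in> X \<Longrightarrow> f x \<le> 1" for f
  proof -
    have "L (\<lambda>x. 1 - f x) \<le> (\<integral>x. 1 - f x \<partial>M)"
      using f f01 by (intro le) (auto intro!: continuous_intros)
    then have "1 - L f \<le> 1 - (\<integral>x. f x \<partial>M)"
      using integrable[OF f] f by (simp add: mean_diff[OF mean] mean_one[OF mean] prob_space)
    then show ?thesis using le[OF f f01] by simp
  qed
  have "(\<integral>x. f x \<partial>M) = L f" if f: "continuous_on X f" for f
  proof -
    have "bounded (f ` X)" using X f by (intro compact_imp_bounded compact_continuous_image)
    then obtain B where B: "0 < B" "\<And>x. x \<in> X \<Longrightarrow> \<bar>f x\<bar> \<le> B" by (auto simp: bounded_pos)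
    \<comment> \<open>An affine change of scale into the unit interval, since the equality is known
      only for functions with values between \<open>0\<close> and \<open>1\<close>.\<close>
    define g where "g x = (f x + B) / (2 * B)" for x
    have g: "continuous_on X g" unfolding g_def using f B by (intro continuous_intros) auto
    have "0 \<le> g x" "g x \<le> 1" if "x \<in> X" for x
      using B(1) B(2)[OF that] by (auto simp: g_def field_simps abs_le_iff)
    then have eq: "(\<integral>x. g x \<partial>M) = L g" using g by (intro eq01)
    have fg: "f = (\<lambda>x. (2 * B) * g x - B)" using B by (auto simp: g_def)
    have "L f = 2 * B * L g - B"
      unfolding fg using g
      by (subst mean_diff[OF mean]) (auto intro!: continuous_intros simp: mean_scale[OF mean] mean_const[OF mean])
    moreover have "(\<integral>x. f x \<partial>M) = 2 * B * (\<integral>x. g x \<partial>M) - B"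
      unfolding fg using integrable[OF g] by (simp add: prob_space)
    ultimately show ?thesis using eq by simp
  qed
  with reg show thesis by (rule that)
qed

section \<open>Invariant measures and the maximal ergodic average\<close>

text \<open>
  The largest value of \<open>\<integral>f\<close> over all invariant probability measures, expressed through
  coboundaries: linear functionals below it are exactly the invariant means.
\<close>

definition invariant_max :: "'a::metric_space set \<Rightarrow> ('a \<Rightarrow> 'a) \<Rightarrow> ('a \<Rightarrow> real) \<Rightarrow> real" where
  "invariant_max X T f = Inf {c. \<exists>h. continuous_on X h \<and> (\<forall>x\<in>X. f x + h x - h (T x) \<le> c)}"

context
  fixes X :: "'a::metric_space set" and T :: "'a \<Rightarrow> 'a"
  assumes X_ne: "X \<noteq> {}" and X: "compact X" and T: "continuous_on X T" "T ` X \<subseteq> X"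
begin

lemma T_mem: "x \<in> X \<Longrightarrow> T x \<in> X"
  using T(2) by auto

lemma continuous_on_T: "continuous_on X f \<Longrightarrow> continuous_on X (\<lambda>x. f (T x))"
  using continuous_on_compose2[OF _ T] .

lemma continuous_bounded:
  fixes f :: "'a \<Rightarrow> real"
  assumes "continuous_on X f"
  obtains B where "0 < B" "\<And>x. x \<in> X \<Longrightarrow> \<bar>f x\<bar> \<le> B"
proof -
  have "bounded (f ` X)" using X assms by (intro compact_imp_bounded compact_continuous_image)
  then show thesis using that by (auto simp: bounded_pos)
qed

text \<open>At a maximum point of \<open>h\<close> the term \<open>h x - h (T x)\<close> is
  nonnegative. This bounds the set in \<open>invariant_max\<close> from below.\<close>

lemma coboundary_bound_ge:
  fixes f h :: "'a \<Rightarrow> real"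
  assumes h: "continuous_on X h" and c: "\<And>x. x \<in> X \<Longrightarrow> f x + h x - h (T x) \<le> c"
    and m: "\<And>x. x \<in> X \<Longrightarrow> m \<le> f x"
  shows "m \<le> c"
proof -
  obtain y where y: "y \<in> X" "\<And>x. x \<in> X \<Longrightarrow> h x \<le> h y"
    using continuous_attains_sup[OF X X_ne h] by blast
  then have "h (T y) \<le> h y" using T_mem by blast
  then show ?thesis using c[OF y(1)] m[OF y(1)] by simp
qed

lemma invariant_max_le:
  assumes f: "continuous_on X f" and h: "continuous_on X h"
    and c: "\<And>x. x \<in> X \<Longrightarrow> f x + h x - h (T x) \<le> c"
  shows "invariant_max X T f \<le> c"
  unfolding invariant_max_def
proof (rule cInf_lower)
  show "c \<in> {c. \<exists>h. continuous_on X h \<and> (\<forall>x\<in>X. f x + h x - h (T x) \<le> c)}"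
    using h c by auto
  obtain B where B: "\<And>x. x \<in> X \<Longrightarrow> \<bar>f x\<bar> \<le> B" using continuous_bounded[OF f] by metis
  show "bdd_below {c. \<exists>h. continuous_on X h \<and> (\<forall>x\<in>X. f x + h x - h (T x) \<le> c)}"
  proof (rule bdd_belowI)
    fix c assume "c \<in> {c. \<exists>h. continuous_on X h \<and> (\<forall>x\<in>X. f x + h x - h (T x) \<le> c)}"
    then obtain h where "continuous_on X h" "\<forall>x\<in>X. f x + h x - h (T x) \<le> c" by blast
    then show "- B \<le> c" using B coboundary_bound_ge[of h f c "- B"] by (force simp: abs_le_iff)
  qed
qed

lemma invariant_max_ge:
  assumes f: "continuous_on X f"
    and "\<And>c h. continuous_on X h \<Longrightarrow> (\<And>x. x \<in> X \<Longrightarrow> f x + h x - h (T x) \<le> c) \<Longrightarrow> a \<le> c"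
  shows "a \<le> invariant_max X T f"
  unfolding invariant_max_def
proof (rule cInf_greatest)
  obtain B where B: "\<And>x. x \<in> X \<Longrightarrow> \<bar>f x\<bar> \<le> B" using continuous_bounded[OF f] by metis
  then have "\<forall>x\<in>X. f x + 0 - 0 \<le> B" by (auto simp: abs_le_iff)
  then have "\<exists>h. continuous_on X h \<and> (\<forall>x\<in>X. f x + h x - h (T x) \<le> B)"
    by (intro exI[of _ "\<lambda>x. 0"]) auto
  then show "{c. \<exists>h. continuous_on X h \<and> (\<forall>x\<in>X. f x + h x - h (T x) \<le> c)} \<noteq> {}" by blast
qed (use assms(2) in blast)

lemma invariant_max_approx:
  assumes f: "continuous_on X f" and e: "0 < e"
  obtains h where "continuous_on X h" "\<And>x. x \<in> X \<Longrightarrow> f x + h x - h (T x) \<le> invariant_max X T f + e"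
proof (rule ccontr)
  assume no: "\<not> thesis"
  note result = that
  have none: "\<not> (\<forall>x\<in>X. f x + h x - h (T x) \<le> invariant_max X T f + e)" if h: "continuous_on X h" for h
    using no result[OF h] by blast
  have "invariant_max X T f + e \<le> invariant_max X T f"
  proof (rule invariant_max_ge[OF f])
    fix c h assume h: "continuous_on X h" "\<And>x. x \<in> X \<Longrightarrow> f x + h x - h (T x) \<le> c"
    obtain x where "x \<in> X" "invariant_max X T f + e < f x + h x - h (T x)"
      using none[OF h(1)] by (auto simp: not_le)
    then show "invariant_max X T f + e \<le> c" using h(2)[of x] by simp
  qed
  with e show False by simp
qed

lemma sublinear_invariant_max: "sublinear_on {f. continuous_on X f} (invariant_max X T)"
  unfolding sublinear_on_def
proof (intro conjI ballI allI impI)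
  fix f g :: "'a \<Rightarrow> real" assume "f \<in> {f. continuous_on X f}" "g \<in> {f. continuous_on X f}"
  then have f: "continuous_on X f" and g: "continuous_on X g" by auto
  have fg: "continuous_on X (\<lambda>x. f x + g x)" using f g by (intro continuous_intros)
  show "invariant_max X T (\<lambda>x. f x + g x) \<le> invariant_max X T f + invariant_max X T g"
  proof (rule field_le_epsilon)
    fix e :: real assume e: "0 < e"
    obtain h where h: "continuous_on X h"
      "\<And>x. x \<in> X \<Longrightarrow> f x + h x - h (T x) \<le> invariant_max X T f + e / 2"
      using invariant_max_approx[OF f, of "e / 2"] e by auto
    obtain k where k: "continuous_on X k"
      "\<And>x. x \<in> X \<Longrightarrow> g x + k x - k (T x) \<le> invariant_max X T g + e / 2"
      using invariant_max_approx[OF g, of "e / 2"] e by auto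
    show "invariant_max X T (\<lambda>x. f x + g x) \<le> invariant_max X T f + invariant_max X T g + e"
    proof (rule invariant_max_le[OF fg, of "\<lambda>x. h x + k x"])
      show "continuous_on X (\<lambda>x. h x + k x)" using h k by (intro continuous_intros)
      show "f x + g x + (h x + k x) - (h (T x) + k (T x)) \<le> invariant_max X T f + invariant_max X T g + e"
        if "x \<in> X" for x using h(2)[OF that] k(2)[OF that] by (simp add: field_simps)
    qed
  qed
next
  fix f :: "'a \<Rightarrow> real" and c :: real assume "f \<in> {f. continuous_on X f}" and c: "0 \<le> c"
  then have f: "continuous_on X f" by auto
  have cf: "continuous_on X (\<lambda>x. c * f x)" using f by (intro continuous_intros)
  show "invariant_max X T (\<lambda>x. c * f x) \<le> c * invariant_max X T f"
  proof (rule field_le_epsilon)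
    fix e :: real assume e: "0 < e"
    \<comment> \<open>Dividing by \<open>c + 1\<close> instead of \<open>c\<close> also covers
      \<open>c = 0\<close>.\<close>
    obtain h where h: "continuous_on X h"
      "\<And>x. x \<in> X \<Longrightarrow> f x + h x - h (T x) \<le> invariant_max X T f + e / (c + 1)"
      using invariant_max_approx[OF f, of "e / (c + 1)"] e c by auto
    show "invariant_max X T (\<lambda>x. c * f x) \<le> c * invariant_max X T f + e"
    proof (rule invariant_max_le[OF cf, of "\<lambda>x. c * h x"])
      show "continuous_on X (\<lambda>x. c * h x)" using h by (intro continuous_intros)
      fix x assume x: "x \<in> X"
      have "c * f x + c * h x - c * h (T x) = c * (f x + h x - h (T x))" by (simp add: algebra_simps)
      also have "\<dots> \<le> c * (invariant_max X T f + e / (c + 1))" using h(2)[OF x] c by (rule mult_left_mono)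
      also have "\<dots> \<le> c * invariant_max X T f + e" using c e by (simp add: field_simps)
      finally show "c * f x + c * h x - c * h (T x) \<le> c * invariant_max X T f + e" .
    qed
  qed
qed

text \<open>With \<open>h = 0\<close> the domination gives \<open>L f \<le> sup f\<close>, hence
  positivity and normalisation. With \<open>h = f\<close> for \<open>f o T - f\<close>, and
  \<open>h = - f\<close> for the opposite difference, the expression vanishes identically, which
  gives invariance.\<close>

lemma dominated_imp_invariant_mean:
  assumes L: "linear_functional_on {f. continuous_on X f} L"
    and dom: "dominated_on {f. continuous_on X f} L (invariant_max X T)"
  shows "mean_on X L" "\<And>f. continuous_on X f \<Longrightarrow> L (\<lambda>x. f (T x)) = L f"
proof -
  have scale: "L (\<lambda>x. c * f x) = c * L f" if "continuous_on X f" for c f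
    using L that by (simp add: linear_functional_on_def)
  have add: "L (\<lambda>x. f x + g x) = L f + L g" if "continuous_on X f" "continuous_on X g" for f g
    using L that by (simp add: linear_functional_on_def)
  have le: "L f \<le> c" if "continuous_on X f" "continuous_on X h"
    "\<And>x. x \<in> X \<Longrightarrow> f x + h x - h (T x) \<le> c" for f h c
    using invariant_max_le[OF that] dom that(1) by (force simp: dominated_on_def)
  have le0: "L f \<le> c" if "continuous_on X f" "\<And>x. x \<in> X \<Longrightarrow> f x \<le> c" for f c
    using le[of f "\<lambda>x. 0" c] that by simp
  have neg: "L (\<lambda>x. - f x) = - L f" if "continuous_on X f" for f
    using scale[OF that, of "-1"] by simp
  have "0 \<le> L f" if "continuous_on X f" "\<And>x. x \<in> X \<Longrightarrow> 0 \<le> f x" for f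
    using le0[of "\<lambda>x. - f x" 0] neg[OF that(1)] that by (simp add: continuous_on_minus)
  moreover have "L (\<lambda>x. 1) = 1"
    using le0[of "\<lambda>x. 1" 1] le0[of "\<lambda>x. -1" "-1"] neg[of "\<lambda>x. 1"] by simp
  ultimately show "mean_on X L" using L by (simp add: mean_on_def)
  fix f :: "'a \<Rightarrow> real" assume f: "continuous_on X f"
  note fT = continuous_on_T[OF f]
  have "L (\<lambda>x. f (T x) + - f x) \<le> 0"
    using f fT by (intro le[of _ f]) (auto intro!: continuous_intros)
  moreover have "L (\<lambda>x. - f (T x) + f x) \<le> 0"
    using f fT by (intro le[of _ "\<lambda>x. - f x"]) (auto intro!: continuous_intros)
  moreover have "L (\<lambda>x. f (T x) + - f x) = L (\<lambda>x. f (T x)) + L (\<lambda>x. - f x)"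
    using f fT by (intro add) (auto intro!: continuous_intros)
  moreover have "L (\<lambda>x. - f (T x) + f x) = L (\<lambda>x. - f (T x)) + L f"
    using f fT by (intro add) (auto intro!: continuous_intros)
  ultimately show "L (\<lambda>x. f (T x)) = L f" using neg[OF f] neg[OF fT] by simp
qed

lemma invariant_mean_imp_dominated:
  assumes mean: "mean_on X L" and inv: "\<And>f. continuous_on X f \<Longrightarrow> L (\<lambda>x. f (T x)) = L f"
  shows "dominated_on {f. continuous_on X f} L (invariant_max X T)"
  unfolding dominated_on_def
proof
  fix f :: "'a \<Rightarrow> real" assume "f \<in> {f. continuous_on X f}"
  then have f: "continuous_on X f" by simp
  show "L f \<le> invariant_max X T f"
  proof (rule invariant_max_ge[OF f])
    fix c and h :: "'a \<Rightarrow> real"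
    assume h: "continuous_on X h" "\<And>x. x \<in> X \<Longrightarrow> f x + h x - h (T x) \<le> c"
    note hT = continuous_on_T[OF h(1)]
    have "L (\<lambda>x. f x + h x - h (T x)) \<le> L (\<lambda>x. c)"
      using f h hT by (intro mean_mono[OF mean]) (auto intro!: continuous_intros)
    moreover have "L (\<lambda>x. f x + h x - h (T x)) = L f + L h - L (\<lambda>x. h (T x))"
      using f h hT by (subst mean_diff[OF mean])
        (auto intro!: continuous_intros simp: mean_add[OF mean])
    ultimately show "L f \<le> c" using inv[OF h(1)] mean_const[OF mean, of c] by simp
  qed
qed

section \<open>Invariant measures and ergodicity of extreme means\<close>

lemma T_measurable:
  assumes M: "sets M = sets (restrict_space borel X)"
  shows "T \<in> measurable M M"
proof -
  have "T \<in> measurable M (restrict_space borel X)"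
    using continuous_measurable[OF M T(1)] space_borel_on[OF M] T_mem
    by (intro measurable_restrict_space2) auto
  then show ?thesis using measurable_cong_sets[OF refl M, of M] by simp
qed

lemma invariant_distr:
  assumes M: "sets M = sets (restrict_space borel X)"
  shows "invariant_measure T M \<longleftrightarrow> distr M M T = M"
proof
  assume inv: "invariant_measure T M"
  show "distr M M T = M"
    using inv T_measurable[OF M]
    by (intro measure_eqI) (auto simp: emeasure_distr invariant_measure_def)
next
  assume eq: "distr M M T = M"
  show "invariant_measure T M"
    unfolding invariant_measure_def
  proof
    fix A assume "A \<in> sets M"
    then have "emeasure (distr M M T) A = emeasure M (T -` A \<inter> space M)"
      by (rule emeasure_distr[OF T_measurable[OF M]])
    then show "emeasure M (T -` A \<inter> space M) = emeasure M A" unfolding eq by simp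
  qed
qed

lemma invariant_integral:
  fixes f :: "'a \<Rightarrow> real"
  assumes M: "sets M = sets (restrict_space borel X)" and inv: "invariant_measure T M"
    and f: "f \<in> borel_measurable M"
  shows "(\<integral>x. f (T x) \<partial>M) = (\<integral>x. f x \<partial>M)"
  using integral_distr[OF T_measurable[OF M] f] invariant_distr[OF M] inv by simp

lemma integral_invariant_imp_invariant_measure:
  assumes M: "sets M = sets (restrict_space borel X)" "finite_measure M"
    and inv: "\<And>f :: 'a \<Rightarrow> real. continuous_on X f \<Longrightarrow> (\<integral>x. f (T x) \<partial>M) = (\<integral>x. f x \<partial>M)"
  shows "invariant_measure T M"
proof -
  have "distr M M T = M"
  proof (rule continuous_integrals_determine_measure[OF X _ _ M])
    show "finite_measure (distr M M T)"
      by (rule finite_measure.finite_measure_distr[OF M(2) T_measurable[OF M(1)]])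
    fix f :: "'a \<Rightarrow> real" assume f: "continuous_on X f"
    show "(\<integral>x. f x \<partial>distr M M T) = (\<integral>x. f x \<partial>M)"
      using integral_distr[OF T_measurable[OF M(1)] continuous_measurable[OF M(1) f]] inv[OF f] by simp
  qed (simp add: M)
  then show ?thesis using invariant_distr[OF M(1)] by simp
qed

text \<open>Conditioning on a strictly invariant set keeps the mean invariant, because
  \<open>indicator A (T x) = indicator A x\<close> on the space.\<close>

lemma conditional_mean:
  assumes M: "sets M = sets (restrict_space borel X)" "prob_space M" and inv: "invariant_measure T M"
    and A: "A \<in> sets M" "T -` A \<inter> space M = A" and pos: "0 < measure M A"
  defines "L \<equiv> \<lambda>f. (\<integral>x. indicator A x * f x \<partial>M) / measure M A"
  shows "mean_on X L" "\<And>f. continuous_on X f \<Longrightarrow> L (\<lambda>x. f (T x)) = L f"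
proof -
  interpret prob_space M by (rule M)
  have int: "integrable M (\<lambda>x. indicator A x * f x)" if "continuous_on X f" for f :: "'a \<Rightarrow> real"
    using integrable_mult_indicator[OF A(1) continuous_integrable[OF M(1) finite_measure_axioms X that]]
    by simp
  show "mean_on X L"
    unfolding mean_on_def linear_functional_on_def
  proof (intro conjI ballI allI impI)
    fix f g :: "'a \<Rightarrow> real" and c :: real
    show "L (\<lambda>x. f x + g x) = L f + L g" if "f \<in> {f. continuous_on X f}" "g \<in> {f. continuous_on X f}"
      using int[of f] int[of g] that by (simp add: L_def distrib_left add_divide_distrib)
    show "L (\<lambda>x. c * f x) = c * L f"
      by (simp add: L_def mult.left_commute[of _ c])
    show "0 \<le> L f" if "\<forall>x\<in>X. 0 \<le> f x"
      unfolding L_def using that space_borel_on[OF M(1)]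
      by (intro divide_nonneg_nonneg integral_nonneg_AE) auto
    show "L (\<lambda>x. 1) = 1" using A pos by (simp add: L_def)
  qed
  fix f :: "'a \<Rightarrow> real" assume f: "continuous_on X f"
  have "(\<integral>x. indicator A x * f (T x) \<partial>M) = (\<integral>x. indicator A (T x) * f (T x) \<partial>M)"
    using A(2) by (intro Bochner_Integration.integral_cong) (auto simp: indicator_def)
  also have "\<dots> = (\<integral>x. indicator A x * f x \<partial>M)"
    using A(1) continuous_measurable[OF M(1) f]
    by (intro invariant_integral[OF M(1) inv, of "\<lambda>x. indicator A x * f x"]) auto
  finally show "L (\<lambda>x. f (T x)) = L f" by (simp add: L_def)
qed

text \<open>An invariant set of measure strictly between \<open>0\<close> and \<open>1\<close> would
  write \<open>L\<close> as a proper convex combination of the two conditional means, each dominated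
  by \<open>invariant_max\<close>.\<close>

lemma extreme_mean_ergodic:
  assumes ext: "extreme_dominated {f. continuous_on X f} (invariant_max X T) L"
    and M: "regular_borel_prob X M" and eq: "\<And>f. continuous_on X f \<Longrightarrow> (\<integral>x. f x \<partial>M) = L f"
  shows "ergodic_measure T M"
proof -
  have sets_M: "sets M = sets (restrict_space borel X)" and prob_M: "prob_space M"
    using M by (auto simp: regular_borel_prob_def)
  interpret prob_space M by (rule prob_M)
  note fin = finite_measure_axioms
  have L: "linear_functional_on {f. continuous_on X f} L"
    and dom: "dominated_on {f. continuous_on X f} L (invariant_max X T)"
    using ext by (auto simp: extreme_dominated_def)
  have inv: "invariant_measure T M"
  proof (rule integral_invariant_imp_invariant_measure[OF sets_M fin])
    fix f :: "'a \<Rightarrow> real" assume f: "continuous_on X f"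
    show "(\<integral>x. f (T x) \<partial>M) = (\<integral>x. f x \<partial>M)"
      using dominated_imp_invariant_mean(2)[OF L dom f] eq[OF f] eq[OF continuous_on_T[OF f]] by simp
  qed
  have "measure M A = 0 \<or> measure M A = 1" if A: "A \<in> sets M" "T -` A \<inter> space M = A" for A
  proof (rule ccontr)
    define s where "s = measure M A"
    assume "\<not> (measure M A = 0 \<or> measure M A = 1)"
    then have s: "0 < s" "s < 1" using measure_nonneg[of M A] prob_le_1[of A] by (auto simp: s_def less_le)
    have B: "space M - A \<in> sets M" "T -` (space M - A) \<inter> space M = space M - A"
      using A T_mem space_borel_on[OF sets_M] by auto
    have sB: "measure M (space M - A) = 1 - s" using prob_compl[OF A(1)] by (simp add: s_def)
    define L1 where "L1 f = (\<integral>x. indicator A x * f x \<partial>M) / measure M A" for f :: "'a \<Rightarrow> real"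
    define L2 where "L2 f = (\<integral>x. indicator (space M - A) x * f x \<partial>M) / measure M (space M - A)"
      for f :: "'a \<Rightarrow> real"
    have m1: "mean_on X L1" and i1: "\<And>f. continuous_on X f \<Longrightarrow> L1 (\<lambda>x. f (T x)) = L1 f"
      unfolding L1_def using conditional_mean[OF sets_M prob_M inv A] s by (auto simp: s_def)
    have m2: "mean_on X L2" and i2: "\<And>f. continuous_on X f \<Longrightarrow> L2 (\<lambda>x. f (T x)) = L2 f"
      unfolding L2_def using conditional_mean[OF sets_M prob_M inv B] s sB by auto
    have conv: "L f = s * L1 f + (1 - s) * L2 f" if f: "continuous_on X f" for f
    proof -
      note intf = continuous_integrable[OF sets_M fin X f]
      have "L f = (\<integral>x. indicator A x * f x + indicator (space M - A) x * f x \<partial>M)"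
        unfolding eq[OF f, symmetric]
        by (intro Bochner_Integration.integral_cong) (auto simp: indicator_def)
      also have "\<dots> = (\<integral>x. indicator A x * f x \<partial>M) + (\<integral>x. indicator (space M - A) x * f x \<partial>M)"
        using integrable_mult_indicator[OF A(1) intf] integrable_mult_indicator[OF B(1) intf]
        by (intro Bochner_Integration.integral_add) auto
      also have "\<dots> = s * L1 f + (1 - s) * L2 f" using s sB by (simp add: L1_def L2_def s_def)
      finally show ?thesis .
    qed
    have "linear_functional_on {f. continuous_on X f} L1" "linear_functional_on {f. continuous_on X f} L2"
      using m1 m2 by (auto simp: mean_on_def)
    moreover have "dominated_on {f. continuous_on X f} L1 (invariant_max X T)"
      by (rule invariant_mean_imp_dominated[OF m1 i1])
    moreover have "dominated_on {f. continuous_on X f} L2 (invariant_max X T)"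
      by (rule invariant_mean_imp_dominated[OF m2 i2])
    moreover have "\<forall>f\<in>{f. continuous_on X f}. L f = s * L1 f + (1 - s) * L2 f" using conv by auto
    ultimately have L1: "L1 f = L f" if "continuous_on X f" for f
      using ext s that unfolding extreme_dominated_def by blast
    \<comment> \<open>Extremality makes the conditional mean on \<open>A\<close> equal to
      \<open>L\<close>. As measures, \<open>M\<close> restricted to \<open>A\<close> is then
      \<open>s\<close> times \<open>M\<close>; evaluating both at \<open>A\<close> gives
      \<open>s = s * s\<close>.\<close>
    define N1 where "N1 = density M (\<lambda>x. ennreal (indicator A x))"
    define N2 where "N2 = density M (\<lambda>x. ennreal s)"
    have "N1 = N2"
    proof (rule continuous_integrals_determine_measure[OF X])
      show "sets N1 = sets (restrict_space borel X)" "sets N2 = sets (restrict_space borel X)"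
        by (auto simp: N1_def N2_def sets_M)
      show "finite_measure N1" "finite_measure N2"
        using A by (auto simp: N1_def N2_def emeasure_density ennreal_indicator emeasure_eq_measure
            nn_integral_cmult ennreal_mult_eq_top_iff intro!: finite_measureI)
      fix f :: "'a \<Rightarrow> real" assume f: "continuous_on X f"
      have fM: "f \<in> borel_measurable M" by (rule continuous_measurable[OF sets_M f])
      have "(\<integral>x. f x \<partial>N1) = s * L1 f"
        unfolding N1_def using fM A s by (subst integral_density) (auto simp: L1_def s_def)
      moreover have "(\<integral>x. f x \<partial>N2) = s * (\<integral>x. f x \<partial>M)"
        unfolding N2_def using fM s by (subst integral_density) auto
      ultimately show "(\<integral>x. f x \<partial>N1) = (\<integral>x. f x \<partial>N2)" using L1[OF f] eq[OF f] by simp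
    qed
    then have "emeasure N1 A = emeasure N2 A" by simp
    then have "ennreal s = ennreal s * ennreal s"
      using A by (simp add: N1_def N2_def emeasure_density nn_integral_cmult ennreal_indicator
          emeasure_eq_measure s_def flip: indicator_inter_arith)
    then have "s = s * s" using s by (simp add: ennreal_mult[symmetric])
    with s show False by simp
  qed
  with inv show ?thesis by (auto simp: ergodic_measure_def)
qed

text \<open>The extreme functional that is maximal at \<open>f\<close> becomes a measure by Riesz.
  Used with \<open>f = 0\<close>, the statement also supplies the existence of an ergodic
  measure.\<close>

theorem maximizing_ergodic_measure:
  assumes f: "continuous_on X f"
  obtains M where "regular_borel_prob X M" "ergodic_measure T M"
    "(\<integral>x. f x \<partial>M) = invariant_max X T f"
proof -
  obtain L where L: "extreme_dominated {f. continuous_on X f} (invariant_max X T) L"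
    "L f = invariant_max X T f"
    using extreme_dominated_functional_exists[OF function_subspace_continuous sublinear_invariant_max, of f] f
    by auto
  have mean: "mean_on X L"
    using dominated_imp_invariant_mean(1) L(1) by (auto simp: extreme_dominated_def)
  obtain M where M: "regular_borel_prob X M" "\<And>f. continuous_on X f \<Longrightarrow> (\<integral>x. f x \<partial>M) = L f"
    using riesz_mean_representation[OF X mean] by metis
  show thesis
    using that[OF M(1) extreme_mean_ergodic[OF L(1) M]] M(2)[OF f] L(2) by simp
qed

end

section \<open>Matching orbits by colours\<close>

text \<open>Choose \<sigma> with the largest number of matches. If a colour \<open>c\<close> were
  unmatched both on the \<open>a\<close> side and on the \<open>b\<close> side, a transposition
  would add a match. So for each \<open>c\<close> one of the two classes of positions contains the
  other, and the unmatched ones number at most the difference of the class sizes.\<close>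

lemma exists_colour_matching:
  fixes a b :: "'i \<Rightarrow> 'c"
  assumes S: "finite S" and K: "finite K" "a ` S \<subseteq> K"
  obtains \<sigma> where "\<sigma> permutes S"
    "real (card {k\<in>S. a k \<noteq> b (\<sigma> k)}) \<le>
       (\<Sum>c\<in>K. \<bar>real (card {k\<in>S. a k = c}) - real (card {k\<in>S. b k = c})\<bar>)"
proof -
  define m where "m \<sigma> = card {k\<in>S. a k = b (\<sigma> k)}" for \<sigma>
  have "finite (m ` {\<sigma>. \<sigma> permutes S})" "m ` {\<sigma>. \<sigma> permutes S} \<noteq> {}"
    using finite_permutations[OF S] permutes_id[of S] by blast+
  then have "Max (m ` {\<sigma>. \<sigma> permutes S}) \<in> m ` {\<sigma>. \<sigma> permutes S}" by (rule Max_in)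
  then obtain \<sigma> where \<sigma>: "\<sigma> permutes S" and "Max (m ` {\<sigma>. \<sigma> permutes S}) = m \<sigma>" by auto
  then have max: "m \<tau> \<le> m \<sigma>" if "\<tau> permutes S" for \<tau>
    using Max_ge[OF \<open>finite (m ` _)\<close>, of "m \<tau>"] that by auto
  have alt: "(\<forall>k\<in>S. a k = c \<longrightarrow> b (\<sigma> k) = c) \<or> (\<forall>k\<in>S. b (\<sigma> k) = c \<longrightarrow> a k = c)" for c
  proof (rule ccontr)
    assume "\<not> ?thesis"
    then obtain j l where j: "j \<in> S" "a j = c" "b (\<sigma> j) \<noteq> c" and l: "l \<in> S" "b (\<sigma> l) = c" "a l \<noteq> c"
      by blast
    define \<tau> where "\<tau> = \<sigma> \<circ> Transposition.transpose j l"
    have "\<tau> permutes S" unfolding \<tau>_def using j l \<sigma> by (intro permutes_compose permutes_swap_id)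
    have \<tau>: "\<tau> k = (if k = j then \<sigma> l else if k = l then \<sigma> j else \<sigma> k)" for k
      by (auto simp: \<tau>_def Transposition.transpose_def)
    \<comment> \<open>No match is lost: before the swap neither \<open>j\<close> nor
      \<open>l\<close> was matched, and afterwards \<open>j\<close> is.\<close>
    have "insert j {k\<in>S. a k = b (\<sigma> k)} \<subseteq> {k\<in>S. a k = b (\<tau> k)}"
      using j l by (auto simp: \<tau>)
    then have "card (insert j {k\<in>S. a k = b (\<sigma> k)}) \<le> m \<tau>"
      unfolding m_def using S by (intro card_mono) auto
    moreover have "card (insert j {k\<in>S. a k = b (\<sigma> k)}) = Suc (m \<sigma>)"
      unfolding m_def using S j by (subst card_insert_disjoint) auto
    ultimately show False using max[OF \<open>\<tau> permutes S\<close>] by simp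
  qed
  have part: "real (card {k\<in>S. a k = c \<and> b (\<sigma> k) \<noteq> c}) \<le>
      \<bar>real (card {k\<in>S. a k = c}) - real (card {k\<in>S. b k = c})\<bar>" for c
    using alt[of c]
  proof
    assume "\<forall>k\<in>S. a k = c \<longrightarrow> b (\<sigma> k) = c"
    then have "{k\<in>S. a k = c \<and> b (\<sigma> k) \<noteq> c} = {}" by auto
    then show ?thesis by (simp only: card.empty)
  next
    assume *: "\<forall>k\<in>S. b (\<sigma> k) = c \<longrightarrow> a k = c"
    have "\<sigma> ` {k\<in>S. b (\<sigma> k) = c} = {k\<in>S. b k = c}"
    proof
      show "\<sigma> ` {k\<in>S. b (\<sigma> k) = c} \<subseteq> {k\<in>S. b k = c}" using permutes_in_image[OF \<sigma>] by auto
      show "{k\<in>S. b k = c} \<subseteq> \<sigma> ` {k\<in>S. b (\<sigma> k) = c}"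
        using permutes_image[OF \<sigma>] by auto
    qed
    then have "card {k\<in>S. b k = c} = card {k\<in>S. b (\<sigma> k) = c}"
      using card_image[of \<sigma> "{k\<in>S. b (\<sigma> k) = c}"] permutes_inj_on[OF \<sigma>] by auto
    moreover have "{k\<in>S. a k = c \<and> b (\<sigma> k) \<noteq> c} = {k\<in>S. a k = c} - {k\<in>S. b (\<sigma> k) = c}" by auto
    moreover have "{k\<in>S. b (\<sigma> k) = c} \<subseteq> {k\<in>S. a k = c}" using * by auto
    ultimately show ?thesis
      using S by (simp add: card_Diff_subset of_nat_diff card_mono)
  qed
  have "{k\<in>S. a k \<noteq> b (\<sigma> k)} \<subseteq> (\<Union>c\<in>K. {k\<in>S. a k = c \<and> b (\<sigma> k) \<noteq> c})" using K by auto
  then have "card {k\<in>S. a k \<noteq> b (\<sigma> k)} \<le> card (\<Union>c\<in>K. {k\<in>S. a k = c \<and> b (\<sigma> k) \<noteq> c})"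
    using S K by (intro card_mono) auto
  also have "\<dots> \<le> (\<Sum>c\<in>K. card {k\<in>S. a k = c \<and> b (\<sigma> k) \<noteq> c})" using K by (intro card_UN_le)
  finally have "real (card {k\<in>S. a k \<noteq> b (\<sigma> k)}) \<le> (\<Sum>c\<in>K. real (card {k\<in>S. a k = c \<and> b (\<sigma> k) \<noteq> c}))"
    using of_nat_mono by fastforce
  also have "\<dots> \<le> (\<Sum>c\<in>K. \<bar>real (card {k\<in>S. a k = c}) - real (card {k\<in>S. b k = c})\<bar>)"
    by (intro sum_mono part)
  finally show thesis by (rule that[OF \<sigma>])
qed

text \<open>The sum starts at the first iterate, as in \<open>F_avg\<close>, so that permutations of
  \<open>{1..n}\<close> merely reindex it.\<close>

definition orbit_avg :: "('a \<Rightarrow> 'a) \<Rightarrow> ('a \<Rightarrow> real) \<Rightarrow> 'a \<Rightarrow> nat \<Rightarrow> real" where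
  "orbit_avg T f x n = (\<Sum>k=1..n. f ((T ^^ k) x)) / real n"

lemma F_avg_le:
  assumes "\<sigma> permutes {1..n}"
  shows "F_avg T x y n \<le> 1 / real n * (\<Sum>k=1..n. dist ((T ^^ k) x) ((T ^^ \<sigma> k) y))"
  unfolding F_avg_def using assms
  by (intro cINF_lower bdd_below_finite finite_imageI finite_permutations) auto

lemma F_avg_ge:
  assumes "\<And>\<sigma>. \<sigma> permutes {1..n} \<Longrightarrow> c \<le> 1 / real n * (\<Sum>k=1..n. dist ((T ^^ k) x) ((T ^^ \<sigma> k) y))"
  shows "c \<le> F_avg T x y n"
  unfolding F_avg_def
proof (rule cINF_greatest)
  show "{\<sigma>. \<sigma> permutes {1..n}} \<noteq> {}" using permutes_id by blast
qed (use assms in simp)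

lemma F_avg_nonneg: "0 \<le> F_avg T x y n"
  by (intro F_avg_ge mult_nonneg_nonneg sum_nonneg) auto

lemma F_avg_le_mismatch:
  assumes \<sigma>: "\<sigma> permutes {1..n}" and e: "0 \<le> e" and D: "0 \<le> D" and n: "0 < n"
    and match: "\<And>k. k \<in> {1..n} \<Longrightarrow> k \<notin> U \<Longrightarrow> dist ((T ^^ k) x) ((T ^^ \<sigma> k) y) \<le> e"
    and all: "\<And>k. k \<in> {1..n} \<Longrightarrow> dist ((T ^^ k) x) ((T ^^ \<sigma> k) y) \<le> D"
    and U: "U \<subseteq> {1..n}" "real (card U) \<le> t * real n"
  shows "F_avg T x y n \<le> e + D * t"
proof -
  have "(\<Sum>k=1..n. dist ((T ^^ k) x) ((T ^^ \<sigma> k) y)) \<le> (\<Sum>k=1..n. e + D * indicator U k)"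
    using match all e D by (intro sum_mono) (force simp: indicator_def)
  also have "\<dots> = n * e + D * real (card U)"
    using U(1) by (simp add: sum.distrib sum_distrib_left[symmetric] indicator_def sum.If_cases Int_absorb1 Int_absorb2)
  also have "\<dots> \<le> n * e + D * (t * n)" using U(2) D by (intro add_left_mono mult_left_mono)
  finally have "(\<Sum>k=1..n. dist ((T ^^ k) x) ((T ^^ \<sigma> k) y)) / n \<le> e + D * t"
    using n by (simp add: divide_le_eq algebra_simps)
  then show ?thesis using F_avg_le[OF \<sigma>, of T x y] by simp
qed

section \<open>Sets with thin boundary\<close>

text \<open>A quantitative form of Riemann integrability with respect to the mean \<open>I\<close>.\<close>

definition sandwiched :: "'a::metric_space set \<Rightarrow> (('a \<Rightarrow> real) \<Rightarrow> real) \<Rightarrow> real \<Rightarrow> ('a \<Rightarrow> real) \<Rightarrow> bool" where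
  "sandwiched X I d u \<longleftrightarrow> (\<exists>g h. continuous_on X g \<and> continuous_on X h \<and>
     (\<forall>x\<in>X. 0 \<le> g x \<and> g x \<le> u x \<and> u x \<le> h x \<and> h x \<le> 1) \<and> I h - I g \<le> d)"

context
  fixes X :: "'a::metric_space set" and I :: "('a \<Rightarrow> real) \<Rightarrow> real"
  assumes mean: "mean_on X I"
begin

lemma sandwiched_one: "sandwiched X I 0 (\<lambda>x. 1)"
  unfolding sandwiched_def by (intro exI[of _ "\<lambda>x. 1"]) auto

lemma sandwiched_compl:
  assumes "sandwiched X I d u" shows "sandwiched X I d (\<lambda>x. 1 - u x)"
proof -
  obtain g h where gh: "continuous_on X g" "continuous_on X h"
    "\<And>x. x \<in> X \<Longrightarrow> 0 \<le> g x \<and> g x \<le> u x \<and> u x \<le> h x \<and> h x \<le> 1" "I h - I g \<le> d"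
    using assms unfolding sandwiched_def by blast
  have "I (\<lambda>x. 1 - g x) - I (\<lambda>x. 1 - h x) \<le> d"
    using gh by (simp add: mean_diff[OF mean])
  moreover have "0 \<le> 1 - h x \<and> 1 - h x \<le> 1 - u x \<and> 1 - u x \<le> 1 - g x \<and> 1 - g x \<le> 1" if "x \<in> X" for x
    using gh(3)[OF that] by auto
  moreover have "continuous_on X (\<lambda>x. 1 - g x)" "continuous_on X (\<lambda>x. 1 - h x)"
    using gh by (auto intro!: continuous_intros)
  ultimately show ?thesis unfolding sandwiched_def by blast
qed

text \<open>The errors add because \<open>h * h' - g * g' = h' * (h - g) + g * (h' - g')\<close>
  with \<open>h'\<close> and \<open>g\<close> at most \<open>1\<close>. Together with complements
  this handles all cells of a partition generated by finitely many sets.\<close>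

lemma sandwiched_mult:
  assumes "sandwiched X I d u" "sandwiched X I e v"
  shows "sandwiched X I (d + e) (\<lambda>x. u x * v x)"
proof -
  obtain g h where gh: "continuous_on X g" "continuous_on X h"
    "\<And>x. x \<in> X \<Longrightarrow> 0 \<le> g x \<and> g x \<le> u x \<and> u x \<le> h x \<and> h x \<le> 1" "I h - I g \<le> d"
    using assms(1) unfolding sandwiched_def by blast
  obtain g' h' where gh': "continuous_on X g'" "continuous_on X h'"
    "\<And>x. x \<in> X \<Longrightarrow> 0 \<le> g' x \<and> g' x \<le> v x \<and> v x \<le> h' x \<and> h' x \<le> 1" "I h' - I g' \<le> e"
    using assms(2) unfolding sandwiched_def by blast
  have c: "continuous_on X (\<lambda>x. g x * g' x)" "continuous_on X (\<lambda>x. h x * h' x)"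
    using gh gh' by (auto intro!: continuous_intros)
  have "h x * h' x - g x * g' x \<le> (h x - g x) + (h' x - g' x)" if "x \<in> X" for x
  proof -
    have "h x * h' x - g x * g' x = h' x * (h x - g x) + g x * (h' x - g' x)" by (simp add: algebra_simps)
    also have "\<dots> \<le> 1 * (h x - g x) + 1 * (h' x - g' x)"
      using gh(3)[OF that] gh'(3)[OF that] by (intro add_mono mult_right_mono) auto
    finally show ?thesis by simp
  qed
  then have "I (\<lambda>x. h x * h' x - g x * g' x) \<le> I (\<lambda>x. (h x - g x) + (h' x - g' x))"
    using gh gh' c by (intro mean_mono[OF mean]) (auto intro!: continuous_intros)
  also have "\<dots> = (I h - I g) + (I h' - I g')"
    using gh gh' by (subst mean_add[OF mean]) (auto intro!: continuous_intros simp: mean_diff[OF mean])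
  finally have "I (\<lambda>x. h x * h' x) - I (\<lambda>x. g x * g' x) \<le> d + e"
    using gh(4) gh'(4) c by (simp add: mean_diff[OF mean])
  moreover have "0 \<le> g x * g' x \<and> g x * g' x \<le> u x * v x \<and> u x * v x \<le> h x * h' x \<and> h x * h' x \<le> 1"
    if "x \<in> X" for x
    using gh(3)[OF that] gh'(3)[OF that] by (auto intro!: mult_mono mult_le_one)
  ultimately show ?thesis unfolding sandwiched_def using c by blast
qed

lemma sandwiched_prod:
  assumes "finite C" "\<And>c. c \<in> C \<Longrightarrow> sandwiched X I d (u c)"
  shows "sandwiched X I (real (card C) * d) (\<lambda>x. \<Prod>c\<in>C. u c x)"
  using assms
proof (induction C rule: finite_induct)
  case empty
  then show ?case using sandwiched_one by simp
next
  case (insert c C)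
  then show ?case
    using sandwiched_mult[of d "u c" "real (card C) * d" "\<lambda>x. \<Prod>c\<in>C. u c x"]
    by (simp add: distrib_right)
qed

text \<open>
  Among \<open>N\<close> disjoint shells around \<open>c\<close> one has mass at most \<open>1/N\<close>; the sphere bounding \<open>B\<close>
  is put into it.
\<close>

lemma sandwiched_ball:
  assumes e: "0 < e" and d: "0 < d"
  obtains B where "ball c e \<subseteq> B" "B \<subseteq> ball c (2 * e)" "sandwiched X I d (indicator B)"
proof -
  obtain N where N: "0 < N" "1 / real N < d" using nat_approx_posE[OF d] by (metis zero_less_Suc)
  \<comment> \<open>The distances from \<open>e\<close> to \<open>2 * e\<close> are rescaled to the
    interval from \<open>0\<close> to \<open>N\<close>. Then \<open>\<phi> k\<close> falls from
    \<open>1\<close> to \<open>0\<close> as \<open>t\<close> runs from \<open>k\<close> to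
    \<open>k + 1\<close>, so the set \<open>t < k + 1\<close> lies between \<open>\<phi> k\<close>
    and \<open>\<phi> (Suc k)\<close>. The increments of the means telescope to at most
    \<open>1\<close>.\<close>
  define t where "t x = real N * (dist c x - e) / e" for x
  define \<phi> where "\<phi> k x = max 0 (min 1 (real k + 1 - t x))" for k :: nat and x
  have \<phi>: "continuous_on X (\<phi> k)" for k
    unfolding \<phi>_def t_def using e by (intro continuous_intros) auto
  have "\<exists>k<N. I (\<phi> (Suc k)) - I (\<phi> k) \<le> 1 / N"
  proof (rule ccontr)
    assume "\<not> ?thesis"
    then have "(\<Sum>k<N. 1 / real N) < (\<Sum>k<N. I (\<phi> (Suc k)) - I (\<phi> k))"
      using N by (intro sum_strict_mono) (auto simp: not_le)
    then have "1 < I (\<phi> N) - I (\<phi> 0)"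
      using N sum_lessThan_telescope[of "\<lambda>k. I (\<phi> k)" N] by simp
    moreover have "I (\<phi> N) \<le> I (\<lambda>x. 1)" by (intro mean_mono[OF mean] \<phi> continuous_on_const) (auto simp: \<phi>_def)
    moreover have "0 \<le> I (\<phi> 0)" by (intro mean_nonneg[OF mean] \<phi>) (auto simp: \<phi>_def)
    ultimately show False using mean_one[OF mean] by simp
  qed
  then obtain k where k: "k < N" "I (\<phi> (Suc k)) - I (\<phi> k) \<le> 1 / N" by blast
  define B where "B = {x. t x < real k + 1}"
  show thesis
  proof (rule that)
    show "ball c e \<subseteq> B"
    proof
      fix x assume "x \<in> ball c e"
      then have "t x \<le> 0" using e by (auto simp: t_def intro!: divide_nonpos_pos mult_nonneg_nonpos)
      then show "x \<in> B" by (simp add: B_def)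
    qed
    show "B \<subseteq> ball c (2 * e)"
    proof
      fix x assume "x \<in> B"
      then have "t x < real N" using k by (simp add: B_def)
      then have "real N * (dist c x - e) < real N * e" using e by (simp add: t_def divide_less_eq)
      then show "x \<in> ball c (2 * e)" using N by simp
    qed
    have "0 \<le> \<phi> k x \<and> \<phi> k x \<le> indicator B x \<and> indicator B x \<le> \<phi> (Suc k) x \<and> \<phi> (Suc k) x \<le> 1" for x
      by (auto simp: \<phi>_def B_def indicator_def)
    then show "sandwiched X I d (indicator B)"
      unfolding sandwiched_def using \<phi> k N by (intro exI[of _ "\<phi> k"] exI[of _ "\<phi> (Suc k)"]) auto
  qed
qed

end

section \<open>Ergodic averages and unique ergodicity\<close>

lemma orbit_avg_card:
  "real n * orbit_avg T (\<lambda>z. if P z then 1 else 0) x n = real (card {k\<in>{1..n}. P ((T ^^ k) x)})"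
  by (simp add: orbit_avg_def sum.If_cases Int_def)

text \<open>Under a colour matching, each matched time costs at most \<open>e\<close>. The unmatched
  times have proportion at most \<eta> per colour and cost at most \<open>D\<close> each.\<close>

lemma F_avg_le_colour_frequencies:
  assumes K: "finite K" "\<And>k. col ((T ^^ k) x) \<in> K" and n: "0 < n" and e: "0 \<le> e" and D: "0 \<le> D"
    and freq: "\<And>c. c \<in> K \<Longrightarrow> \<bar>orbit_avg T (\<lambda>z. if col z = c then 1 else 0) x n -
      orbit_avg T (\<lambda>z. if col z = c then 1 else 0) y n\<bar> \<le> \<eta>"
    and near: "\<And>k l. col ((T ^^ k) x) = col ((T ^^ l) y) \<Longrightarrow> dist ((T ^^ k) x) ((T ^^ l) y) \<le> e"
    and all: "\<And>k l. dist ((T ^^ k) x) ((T ^^ l) y) \<le> D"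
  shows "F_avg T x y n \<le> e + D * (real (card K) * \<eta>)"
proof -
  define a where "a k = col ((T ^^ k) x)" for k
  define b where "b k = col ((T ^^ k) y)" for k
  have aK: "a ` {1..n} \<subseteq> K" using K(2) by (auto simp: a_def)
  obtain \<sigma> where \<sigma>: "\<sigma> permutes {1..n}"
    and card: "real (card {k\<in>{1..n}. a k \<noteq> b (\<sigma> k)}) \<le>
      (\<Sum>c\<in>K. \<bar>real (card {k\<in>{1..n}. a k = c}) - real (card {k\<in>{1..n}. b k = c})\<bar>)"
    by (rule exists_colour_matching[OF finite_atLeastAtMost K(1) aK, where b = b])
  have "(\<Sum>c\<in>K. \<bar>real (card {k\<in>{1..n}. a k = c}) - real (card {k\<in>{1..n}. b k = c})\<bar>)
      \<le> (\<Sum>c\<in>K. real n * \<eta>)"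
  proof (rule sum_mono)
    fix c assume c: "c \<in> K"
    let ?p = "\<lambda>x. orbit_avg T (\<lambda>z. if col z = c then 1 else 0) x n"
    have "\<bar>real (card {k\<in>{1..n}. a k = c}) - real (card {k\<in>{1..n}. b k = c})\<bar> =
        \<bar>real n * ?p x - real n * ?p y\<bar>"
      unfolding orbit_avg_card by (simp add: a_def b_def)
    also have "\<dots> = real n * \<bar>?p x - ?p y\<bar>" by (simp add: abs_mult right_diff_distrib[symmetric])
    also have "\<dots> \<le> real n * \<eta>" using freq[OF c] by (intro mult_left_mono) auto
    finally show "\<bar>real (card {k\<in>{1..n}. a k = c}) - real (card {k\<in>{1..n}. b k = c})\<bar> \<le> real n * \<eta>" .
  qed
  with card have "real (card {k\<in>{1..n}. a k \<noteq> b (\<sigma> k)}) \<le> (real (card K) * \<eta>) * real n"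
    by (simp add: mult_ac)
  then show ?thesis
    using near all by (intro F_avg_le_mismatch[OF \<sigma> e D n]) (auto simp: a_def b_def)
qed

lemma prod_indicator_colour:
  assumes "finite C" "S \<subseteq> C"
  shows "(\<Prod>c\<in>C. if c \<in> S then indicator (B c) z else 1 - indicator (B c) z) =
    (if {c\<in>C. z \<in> B c} = S then 1 else 0 :: real)"
proof (cases "{c\<in>C. z \<in> B c} = S")
  case True
  then show ?thesis by (auto intro!: prod.neutral simp: indicator_def)
next
  case False
  then obtain c where "c \<in> C" "c \<in> S \<longleftrightarrow> z \<notin> B c" using assms by blast
  then show ?thesis using False assms by (auto intro!: bexI[of _ c] simp: indicator_def)
qed

context
  fixes X :: "'a::metric_space set" and T :: "'a \<Rightarrow> 'a"
  assumes X_ne: "X \<noteq> {}" and X: "compact X" and T: "continuous_on X T" "T ` X \<subseteq> X"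
begin

lemma funpow_mem: "x \<in> X \<Longrightarrow> (T ^^ k) x \<in> X"
  using T by (induction k) auto

lemma continuous_on_funpow: "continuous_on X (T ^^ k)"
proof (induction k)
  case (Suc k)
  then show ?case using continuous_on_compose2[OF T(1) Suc] funpow_mem by (auto simp: comp_def)
qed (simp add: id_def)

lemma orbit_avg_mono:
  assumes "x \<in> X" "\<And>z. z \<in> X \<Longrightarrow> f z \<le> g z"
  shows "orbit_avg T f x n \<le> orbit_avg T g x n"
  unfolding orbit_avg_def using assms funpow_mem by (intro divide_right_mono sum_mono) auto

text \<open>A nearly optimal coboundary bounds \<open>f + h - h o T\<close> pointwise. Summed along
  the orbit, the \<open>h\<close> terms telescope and leave at most \<open>2 * B\<close>.\<close>

lemma orbit_avg_eventually_le:
  assumes f: "continuous_on X f" and x: "x \<in> X" and e: "0 < e"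
  shows "eventually (\<lambda>n. orbit_avg T f x n \<le> invariant_max X T f + e) sequentially"
proof -
  obtain h where h: "continuous_on X h"
    "\<And>x. x \<in> X \<Longrightarrow> f x + h x - h (T x) \<le> invariant_max X T f + e / 2"
    using invariant_max_approx[OF X_ne X T f, of "e / 2"] e by auto
  obtain B where B: "0 < B" "\<And>x. x \<in> X \<Longrightarrow> \<bar>h x\<bar> \<le> B"
    using continuous_bounded[OF X_ne X T h(1)] by metis
  \<comment> \<open>From \<open>4 * B / e\<close> on, the telescoped remainder \<open>2 * B\<close>
    is at most \<open>n * (e / 2)\<close>; the added \<open>1\<close> makes \<open>n\<close>
    positive.\<close>
  have "eventually (\<lambda>n. 4 * B / e + 1 \<le> real n) sequentially"
    using filterlim_real_sequentially unfolding filterlim_at_top by blast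
  then show ?thesis
  proof eventually_elim
    case (elim n)
    have n: "0 < n" using elim B e by (intro Nat.gr0I) (auto simp: field_simps)
    have "(\<Sum>k=1..n. f ((T ^^ k) x) + (h ((T ^^ k) x) - h ((T ^^ Suc k) x))) \<le>
        (\<Sum>k=1..n. invariant_max X T f + e / 2)"
      using h(2)[OF funpow_mem[OF x]] by (intro sum_mono) (simp add: algebra_simps)
    moreover have "(\<Sum>k=1..n. h ((T ^^ k) x) - h ((T ^^ Suc k) x)) = h (T x) - h ((T ^^ Suc n) x)"
      by (induction n) auto
    moreover have "- (2 * B) \<le> h (T x) - h ((T ^^ Suc n) x)"
      using B(2)[OF funpow_mem[OF x, of 1]] B(2)[OF funpow_mem[OF x, of "Suc n"]] by simp
    ultimately have "(\<Sum>k=1..n. f ((T ^^ k) x)) \<le> n * (invariant_max X T f + e / 2) + 2 * B"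
      by (simp add: sum.distrib)
    also have "2 * B \<le> n * (e / 2)" using elim e B by (simp add: field_simps)
    finally show ?case using n by (simp add: orbit_avg_def divide_le_eq algebra_simps)
  qed
qed

text \<open>The maximising ergodic measures for \<open>f\<close> and for \<open>- f\<close>
  coincide, so the largest and the smallest invariant integral of \<open>f\<close> agree, and the
  two one-sided bounds on the averages close up.\<close>

lemma uniquely_ergodic_averages:
  assumes "uniquely_ergodic X T"
  obtains I where "mean_on X I"
    "\<And>f x. continuous_on X f \<Longrightarrow> x \<in> X \<Longrightarrow> orbit_avg T f x \<longlonglongrightarrow> I f"
proof -
  obtain M where M: "regular_borel_prob X M" "ergodic_measure T M"
    and uniq: "\<And>N. regular_borel_prob X N \<Longrightarrow> ergodic_measure T N \<Longrightarrow> N = M"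
    using assms unfolding uniquely_ergodic_def by auto
  have sets_M: "sets M = sets (restrict_space borel X)" and "prob_space M"
    using M by (auto simp: regular_borel_prob_def)
  interpret prob_space M by fact
  define I where "I f = (\<integral>x. f x \<partial>M)" for f :: "'a \<Rightarrow> real"
  have max: "invariant_max X T f = I f" if f: "continuous_on X f" for f
    using maximizing_ergodic_measure[OF X_ne X T f] uniq unfolding I_def by metis
  have int: "integrable M f" if "continuous_on X f" for f :: "'a \<Rightarrow> real"
    by (rule continuous_integrable[OF sets_M finite_measure_axioms X that])
  have "mean_on X I"
    unfolding mean_on_def linear_functional_on_def I_def
    using int space_borel_on[OF sets_M] by (auto intro!: integral_nonneg_AE simp: prob_space)
  moreover have "orbit_avg T f x \<longlonglongrightarrow> I f" if f: "continuous_on X f" and x: "x \<in> X" for f x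
  proof (rule LIMSEQ_I)
    fix r :: real assume r: "0 < r"
    have nf: "continuous_on X (\<lambda>x. - f x)" using f by (rule continuous_on_minus)
    have neg: "orbit_avg T (\<lambda>x. - f x) x n = - orbit_avg T f x n" for n
      by (simp add: orbit_avg_def sum_negf)
    have "eventually (\<lambda>n. orbit_avg T f x n \<le> I f + r / 2) sequentially"
      using orbit_avg_eventually_le[OF f x, of "r / 2"] r max[OF f] by simp
    moreover have "eventually (\<lambda>n. - orbit_avg T f x n \<le> - I f + r / 2) sequentially"
      using orbit_avg_eventually_le[OF nf x, of "r / 2"] r max[OF nf] neg by (simp add: I_def)
    ultimately have "eventually (\<lambda>n. norm (orbit_avg T f x n - I f) < r) sequentially"
      by eventually_elim (use r in \<open>auto simp: abs_less_iff\<close>)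
    then show "\<exists>no. \<forall>n\<ge>no. norm (orbit_avg T f x n - I f) < r"
      by (simp add: eventually_sequentially)
  qed
  ultimately show thesis by (rule that)
qed

lemma sandwiched_frequencies:
  assumes lim: "\<And>f x. continuous_on X f \<Longrightarrow> x \<in> X \<Longrightarrow> orbit_avg T f x \<longlonglongrightarrow> I f"
    and u: "sandwiched X I d u" and d: "d < e" and x: "x \<in> X" and y: "y \<in> X"
  shows "eventually (\<lambda>n. \<bar>orbit_avg T u x n - orbit_avg T u y n\<bar> < e) sequentially"
proof -
  obtain g h where gh: "continuous_on X g" "continuous_on X h"
    "\<And>x. x \<in> X \<Longrightarrow> 0 \<le> g x \<and> g x \<le> u x \<and> u x \<le> h x \<and> h x \<le> 1" "I h - I g \<le> d"
    using u unfolding sandwiched_def by blast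
  \<comment> \<open>A slack of \<open>r\<close> is spent at the upper and at the lower end: the
    frequencies lie in an interval of length at most \<open>d + 2 * r = e\<close>.\<close>
  define r where "r = (e - d) / 2"
  have r: "0 < r" using d by (simp add: r_def)
  have upper: "eventually (\<lambda>n. orbit_avg T u z n < I h + r) sequentially" if z: "z \<in> X" for z
  proof -
    have "eventually (\<lambda>n. orbit_avg T h z n < I h + r) sequentially"
      using order_tendstoD(2)[OF lim[OF gh(2) z]] r by simp
    moreover have "orbit_avg T u z n \<le> orbit_avg T h z n" for n
      by (rule orbit_avg_mono[OF z]) (use gh(3) in auto)
    ultimately show ?thesis by (auto elim!: eventually_mono intro: le_less_trans)
  qed
  have lower: "eventually (\<lambda>n. I g - r < orbit_avg T u z n) sequentially" if z: "z \<in> X" for z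
  proof -
    have "eventually (\<lambda>n. I g - r < orbit_avg T g z n) sequentially"
      using order_tendstoD(1)[OF lim[OF gh(1) z]] r by simp
    moreover have "orbit_avg T g z n \<le> orbit_avg T u z n" for n
      by (rule orbit_avg_mono[OF z]) (use gh(3) in auto)
    ultimately show ?thesis by (auto elim!: eventually_mono intro: less_le_trans)
  qed
  show ?thesis
    using upper[OF x] upper[OF y] lower[OF x] lower[OF y]
    by eventually_elim (use gh(4) in \<open>simp add: r_def abs_less_iff field_simps\<close>)
qed

lemma uniquely_ergodic_imp_F_avg_tendsto_0:
  assumes ue: "uniquely_ergodic X T" and x: "x \<in> X" and y: "y \<in> X"
  shows "F_avg T x y \<longlonglongrightarrow> 0"
proof -
  obtain I where mean: "mean_on X I"
    and lim: "\<And>f x. continuous_on X f \<Longrightarrow> x \<in> X \<Longrightarrow> orbit_avg T f x \<longlonglongrightarrow> I f"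
    using uniquely_ergodic_averages[OF ue] by metis
  obtain D where D: "0 < D" "\<And>u v. u \<in> X \<Longrightarrow> v \<in> X \<Longrightarrow> dist u v \<le> D"
  proof -
    obtain a b where "\<forall>x\<in>X. dist a x \<le> b" using compact_imp_bounded[OF X] by (auto simp: bounded_def)
    then have "dist u v \<le> 2 * \<bar>b\<bar> + 1" if "u \<in> X" "v \<in> X" for u v
    proof -
      have "dist a u \<le> b" "dist a v \<le> b" using \<open>\<forall>x\<in>X. dist a x \<le> b\<close> that by auto
      then show ?thesis using dist_triangle3[of u v a] by linarith
    qed
    then show thesis by (intro that[of "2 * \<bar>b\<bar> + 1"]) auto
  qed
  show ?thesis
  proof (rule LIMSEQ_I)
    fix r :: real assume r: "0 < r"
    \<comment> \<open>Points of equal colour lie in a common ball of radius \<open>2 * e\<close>, so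
      a match costs at most \<open>4 * e = r / 4\<close>; the mismatches are allotted
      \<open>r / 2\<close>.\<close>
    define e where "e = r / 16"
    have e: "0 < e" using r by (simp add: e_def)
    have "X \<subseteq> (\<Union>c\<in>X. ball c e)" using e by auto
    then obtain C where C: "C \<subseteq> X" "finite C" "X \<subseteq> (\<Union>c\<in>C. ball c e)"
      by (rule compactE_image[OF X open_ball])
    \<comment> \<open>There are \<open>2 ^ card C\<close> colours, one for each subset of
      \<open>C\<close>, so \<open>D\<close> times the total mismatch is
      \<open>r / 2\<close>.\<close>
    define \<eta> where "\<eta> = r / (2 * D * 2 ^ card C)"
    have \<eta>: "0 < \<eta>" using r D by (simp add: \<eta>_def)
    \<comment> \<open>A cell is an intersection of \<open>card C\<close> sets or complements, each
      with sandwich error \<open>d\<close>; the sum of these errors has to stay strictly below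
      \<eta>.\<close>
    define d where "d = \<eta> / (2 * (real (card C) + 1))"
    have d: "0 < d" using \<eta> by (simp add: d_def)
    have Cd: "real (card C) * d < \<eta>"
    proof -
      have "real (card C) * d \<le> (real (card C) + 1) * d" using d by simp
      also have "\<dots> = \<eta> / 2" by (simp add: d_def field_simps)
      finally show ?thesis using \<eta> by simp
    qed
    have "\<exists>B. ball c e \<subseteq> B \<and> B \<subseteq> ball c (2 * e) \<and> sandwiched X I d (indicator B)" for c
      using sandwiched_ball[OF mean e d] by metis
    then obtain B where B: "\<And>c. ball c e \<subseteq> B c" "\<And>c. B c \<subseteq> ball c (2 * e)"
      "\<And>c. sandwiched X I d (indicator (B c))" by metis
    define colour where "colour z = {c\<in>C. z \<in> B c}" for z
    have near: "dist u v \<le> 4 * e" if "u \<in> X" "colour u = colour v" for u v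
    proof -
      \<comment> \<open>The small balls cover \<open>X\<close>, so the colour of \<open>u\<close> is
        nonempty, and any centre in it is shared with \<open>v\<close>.\<close>
      obtain c where "c \<in> C" "u \<in> ball c e" using C(3) \<open>u \<in> X\<close> by blast
      then have "c \<in> colour u" using subsetD[OF B(1)] by (auto simp: colour_def)
      then have "u \<in> ball c (2 * e)" "v \<in> ball c (2 * e)"
        using subsetD[OF B(2)[of c]] that(2) unfolding colour_def by blast+
      then show ?thesis using dist_triangle3[of u v c] by simp
    qed
    define freq where "freq S z n = orbit_avg T (\<lambda>w. if colour w = S then 1 else 0) z n" for S z n
    have "eventually (\<lambda>n. \<bar>freq S x n - freq S y n\<bar> < \<eta>) sequentially" if S: "S \<in> Pow C" for S
    proof -
      define u where "u c = (if c \<in> S then indicator (B c) else (\<lambda>z. 1 - indicator (B c) z :: real))" for c :: 'a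
      have "sandwiched X I d (u c)" for c
        unfolding u_def using B(3) sandwiched_compl[OF mean B(3)] by auto
      then have "sandwiched X I (real (card C) * d) (\<lambda>z. \<Prod>c\<in>C. u c z)"
        using sandwiched_prod[OF mean C(2), of d u] by simp
      moreover have "(\<Prod>c\<in>C. u c z) = (if colour z = S then 1 else 0)" for z
      proof -
        have "(\<Prod>c\<in>C. u c z) = (\<Prod>c\<in>C. if c \<in> S then indicator (B c) z else 1 - indicator (B c) z)"
          by (intro prod.cong) (auto simp: u_def)
        then show ?thesis using prod_indicator_colour[OF C(2), of S B z] S by (simp add: colour_def)
      qed
      ultimately have "sandwiched X I (real (card C) * d) (\<lambda>z. if colour z = S then 1 else 0)" by simp
      from sandwiched_frequencies[OF lim this Cd x y] show ?thesis by (simp add: freq_def)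
    qed
    then have "eventually (\<lambda>n. \<forall>S\<in>Pow C. \<bar>freq S x n - freq S y n\<bar> < \<eta>) sequentially"
      using C(2) by (intro eventually_ball_finite) auto
    then have "eventually (\<lambda>n. norm (F_avg T x y n - 0) < r) sequentially"
      using eventually_gt_at_top[of "0::nat"]
    proof eventually_elim
      case (elim n)
      have "F_avg T x y n \<le> 4 * e + D * (card (Pow C) * \<eta>)"
      proof (rule F_avg_le_colour_frequencies[where col = colour])
        show "\<bar>orbit_avg T (\<lambda>z. if colour z = S then 1 else 0) x n -
            orbit_avg T (\<lambda>z. if colour z = S then 1 else 0) y n\<bar> \<le> \<eta>" if "S \<in> Pow C" for S
          using elim(1) that unfolding freq_def by (simp add: less_imp_le)
        show "dist ((T ^^ k) x) ((T ^^ l) y) \<le> 4 * e" if "colour ((T ^^ k) x) = colour ((T ^^ l) y)" for k l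
          using near[OF funpow_mem[OF x] that] .
        show "dist ((T ^^ k) x) ((T ^^ l) y) \<le> D" for k l
          using D(2)[OF funpow_mem[OF x] funpow_mem[OF y]] .
      qed (use C(2) e D(1) elim(2) in \<open>auto simp: colour_def\<close>)
      also have "card (Pow C) = 2 ^ card C" using C(2) by (rule card_Pow)
      also have "D * (real (2 ^ card C) * \<eta>) = r / 2" using D by (simp add: \<eta>_def)
      finally show ?case using F_avg_nonneg[of T x y n] r by (simp add: e_def)
    qed
    then show "\<exists>no. \<forall>n\<ge>no. norm (F_avg T x y n - 0) < r" by (simp add: eventually_sequentially)
  qed
qed

section \<open>From vanishing lower limits to unique ergodicity\<close>

lemma orbit_avg_le_for_all_times:
  assumes M: "sets M = sets (restrict_space borel X)" "prob_space M" and inv: "invariant_measure T M"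
    and f: "continuous_on X f" and c: "(\<integral>x. f x \<partial>M) < c"
  obtains x where "x \<in> X" "\<And>n. 0 < n \<Longrightarrow> orbit_avg T f x n \<le> c"
proof (rule ccontr)
  assume no: "\<not> thesis"
  note result = that
  interpret prob_space M by (rule M)
  define S where "S m x = (\<Sum>k=1..m. f ((T ^^ k) x) - c)" for m x
  have S_eq: "S m x = real m * orbit_avg T f x m - real m * c" for m x
    by (simp add: S_def orbit_avg_def sum_subtractf)
  have ex: "\<exists>n>0. 0 < S n x" if x: "x \<in> X" for x
  proof (rule ccontr)
    assume *: "\<not> ?thesis"
    have "orbit_avg T f x n \<le> c" if n: "0 < n" for n
    proof -
      have "\<not> 0 < S n x" using * n by blast
      then show ?thesis using n by (simp add: S_eq)
    qed
    then show False using no result[OF x] by blast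
  qed
  have fk: "continuous_on X (\<lambda>x. f ((T ^^ k) x))" for k
    using continuous_on_compose2[OF f continuous_on_funpow] funpow_mem by blast
  have S: "continuous_on X (S m)" for m
    unfolding S_def using fk by (intro continuous_intros)
  have "\<exists>W. open W \<and> {x\<in>X. 0 < S n x} = X \<inter> W" for n
    using continuous_openin_preimage_gen[OF S, of "{0<..}" n] by (auto simp: openin_open vimage_def Int_def)
  then obtain W where W: "\<And>n. open (W n)" "\<And>n. {x\<in>X. 0 < S n x} = X \<inter> W n" by metis
  \<comment> \<open>If no point is as desired, every point has a positive sum \<open>S n x\<close>
    at some time. This is an open condition for each \<open>n\<close>, so compactness bounds the
    waiting time by \<open>N\<close>.\<close>
  have "X \<subseteq> (\<Union>n\<in>{0<..}. W n)" using ex W(2) by blast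
  then obtain D where D: "D \<subseteq> {0<..}" "finite D" "X \<subseteq> (\<Union>n\<in>D. W n)"
    by (rule compactE_image[OF X W(1)])
  define N where "N = Max (insert 0 D)"
  have bounded_time: "\<exists>n>0. n \<le> N \<and> 0 < S n x" if x: "x \<in> X" for x
  proof -
    obtain n where n: "n \<in> D" "x \<in> W n" using D(3) x by blast
    then show ?thesis using x W(2)[of n] D by (auto simp: N_def intro!: exI[of _ n])
  qed
  have "continuous_on X (\<lambda>x. f x - c)" using f by (intro continuous_intros)
  then obtain B where B: "0 < B" "\<And>x. x \<in> X \<Longrightarrow> \<bar>f x - c\<bar> \<le> B"
    using continuous_bounded[OF X_ne X T] by metis
  \<comment> \<open>Blocks with positive sum are removed one after another from the start of the
    orbit; only the last incomplete block, of length at most \<open>N\<close>, can contribute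
    negatively.\<close>
  have chop: "- (real N * B) \<le> S m x" if "x \<in> X" for m x
    using that
  proof (induction m arbitrary: x rule: less_induct)
    case (less m)
    show ?case
    proof (cases "m \<le> N")
      case True
      have "- B \<le> f ((T ^^ k) x) - c" for k
        using B(2)[OF funpow_mem[OF less.prems], of k] by linarith
      then have "(\<Sum>k=1..m. - B) \<le> S m x" unfolding S_def by (intro sum_mono)
      moreover have "real m * B \<le> real N * B" using True B by simp
      ultimately show ?thesis by simp
    next
      case False
      obtain n where n: "0 < n" "n \<le> N" "0 < S n x" using bounded_time[OF less.prems] by blast
      have "S m x = S n x + (\<Sum>k=n+1..m. f ((T ^^ k) x) - c)"
        unfolding S_def using n False sum.ub_add_nat[of 1 n "\<lambda>k. f ((T ^^ k) x) - c" "m - n"] by simp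
      also have "(\<Sum>k=n+1..m. f ((T ^^ k) x) - c) = S (m - n) ((T ^^ n) x)"
      proof -
        have "(\<Sum>k=1+n..(m-n)+n. f ((T ^^ k) x) - c) = (\<Sum>k=1..m-n. f ((T ^^ (k + n)) x) - c)"
          by (rule sum.shift_bounds_cl_nat_ivl)
        then show ?thesis using n False by (simp add: S_def funpow_add)
      qed
      finally show ?thesis
        using less.IH[of "m - n" "(T ^^ n) x"] funpow_mem[OF less.prems] n False by simp
    qed
  qed
  have int: "integrable M g" if "continuous_on X g" for g :: "'a \<Rightarrow> real"
    by (rule continuous_integrable[OF M(1) finite_measure_axioms X that])
  have inv_k: "(\<integral>x. f ((T ^^ k) x) \<partial>M) = (\<integral>x. f x \<partial>M)" for k
  proof (induction k)
    case (Suc k)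
    have "(\<integral>x. f ((T ^^ k) (T x)) \<partial>M) = (\<integral>x. f ((T ^^ k) x) \<partial>M)"
      by (rule invariant_integral[OF X_ne X T M(1) inv continuous_measurable[OF M(1) fk]])
    then show ?case using Suc by (simp add: funpow_swap1)
  qed simp
  \<comment> \<open>Integrating the chopped bound leaves an error independent of \<open>m\<close>,
    while the right-hand side tends to minus infinity because the integral is below
    \<open>c\<close>.\<close>
  have lower: "- (real N * B) \<le> real m * ((\<integral>x. f x \<partial>M) - c)" for m
  proof -
    have "(\<integral>x. - (real N * B) \<partial>M) \<le> (\<integral>x. S m x \<partial>M)"
      using chop space_borel_on[OF M(1)] int[OF S] by (intro integral_mono) auto
    also have "(\<integral>x. S m x \<partial>M) = (\<Sum>k=1..m. (\<integral>x. f x \<partial>M) - c)"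
      unfolding S_def using int[OF fk] inv_k by (simp add: prob_space)
    finally show ?thesis by (simp add: prob_space)
  qed
  obtain m :: nat where "real N * B < real m * (c - (\<integral>x. f x \<partial>M))"
    using reals_Archimedean3[of "c - (\<integral>x. f x \<partial>M)"] c by auto
  moreover have "real m * (c - (\<integral>x. f x \<partial>M)) = - (real m * ((\<integral>x. f x \<partial>M) - c))"
    by (simp add: algebra_simps)
  ultimately have "real N * B < - (real m * ((\<integral>x. f x \<partial>M) - c))" by simp
  with lower[of m] show False by linarith
qed

text \<open>Nearby points are handled by uniform continuity. At distance at least \<open>d\<close>
  the full oscillation \<open>2 * B\<close> is below \<open>2 * B / d\<close> times the distance. A
  bound linear in the distance is what can be averaged against \<open>F_avg\<close>.\<close>

lemma continuous_le_linear_modulus: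
  fixes f :: "'a \<Rightarrow> real"
  assumes f: "continuous_on X f" and e: "0 < e"
  obtains K where "0 < K" "\<And>u v. u \<in> X \<Longrightarrow> v \<in> X \<Longrightarrow> \<bar>f u - f v\<bar> \<le> e + K * dist u v"
proof -
  obtain B where B: "0 < B" "\<And>x. x \<in> X \<Longrightarrow> \<bar>f x\<bar> \<le> B"
    using continuous_bounded[OF X_ne X T f] by metis
  have "uniformly_continuous_on X f" using f X by (rule compact_uniformly_continuous)
  then obtain d where d: "0 < d" "\<And>u v. u \<in> X \<Longrightarrow> v \<in> X \<Longrightarrow> dist v u < d \<Longrightarrow> dist (f v) (f u) < e"
    using e unfolding uniformly_continuous_on_def by metis
  have "\<bar>f u - f v\<bar> \<le> e + 2 * B / d * dist u v" if uv: "u \<in> X" "v \<in> X" for u v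
  proof (cases "dist u v < d")
    case True
    then have "\<bar>f u - f v\<bar> < e" using d(2)[OF uv(2,1)] by (simp add: dist_real_def)
    moreover have "0 \<le> 2 * B / d * dist u v" using B d by (intro mult_nonneg_nonneg) auto
    ultimately show ?thesis by simp
  next
    case False
    then have "2 * B / d * d \<le> 2 * B / d * dist u v" using B d by (intro mult_left_mono) auto
    then show ?thesis using B(2)[OF uv(1)] B(2)[OF uv(2)] d e by (auto simp: abs_le_iff)
  qed
  then show thesis using B d by (intro that[of "2 * B / d"]) auto
qed

text \<open>The average of \<open>f\<close> over the orbit of \<open>y\<close> is unchanged by
  permuting times, so the linear modulus applies to the pairs formed by any \<sigma>.\<close>

lemma orbit_avg_diff_le_F_avg:
  fixes f :: "'a \<Rightarrow> real"
  assumes K: "0 < K" "\<And>u v. u \<in> X \<Longrightarrow> v \<in> X \<Longrightarrow> \<bar>f u - f v\<bar> \<le> e + K * dist u v"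
    and x: "x \<in> X" and y: "y \<in> X" and n: "0 < n"
  shows "\<bar>orbit_avg T f x n - orbit_avg T f y n\<bar> \<le> e + K * F_avg T x y n"
proof -
  have "(\<bar>orbit_avg T f x n - orbit_avg T f y n\<bar> - e) / K \<le> F_avg T x y n"
  proof (rule F_avg_ge)
    fix \<sigma> assume \<sigma>: "\<sigma> permutes {1..n}"
    have "(\<Sum>k=1..n. f ((T ^^ k) y)) = (\<Sum>k=1..n. f ((T ^^ \<sigma> k) y))"
      using sum.permute[OF \<sigma>, of "\<lambda>k. f ((T ^^ k) y)"] by (simp add: comp_def)
    then have "\<bar>orbit_avg T f x n - orbit_avg T f y n\<bar> =
        \<bar>\<Sum>k=1..n. f ((T ^^ k) x) - f ((T ^^ \<sigma> k) y)\<bar> / n"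
      by (simp add: orbit_avg_def sum_subtractf diff_divide_distrib[symmetric] abs_divide)
    also have "\<dots> \<le> (\<Sum>k=1..n. \<bar>f ((T ^^ k) x) - f ((T ^^ \<sigma> k) y)\<bar>) / n"
      by (intro divide_right_mono sum_abs) simp
    also have "\<dots> \<le> (\<Sum>k=1..n. e + K * dist ((T ^^ k) x) ((T ^^ \<sigma> k) y)) / n"
      using K(2) funpow_mem x y by (intro divide_right_mono sum_mono) auto
    also have "\<dots> = e + K * (1 / real n * (\<Sum>k=1..n. dist ((T ^^ k) x) ((T ^^ \<sigma> k) y)))"
      using n by (simp add: sum.distrib sum_distrib_left[symmetric] field_simps)
    finally show "(\<bar>orbit_avg T f x n - orbit_avg T f y n\<bar> - e) / K \<le>
        1 / real n * (\<Sum>k=1..n. dist ((T ^^ k) x) ((T ^^ \<sigma> k) y))"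
      using K(1) by (simp add: divide_le_eq mult.commute)
  qed
  then show ?thesis using K(1) by (simp add: divide_le_eq mult.commute)
qed

lemma F_lower_zero_imp_integral_le:
  fixes f :: "'a \<Rightarrow> real"
  assumes F: "\<And>x y. x \<in> X \<Longrightarrow> y \<in> X \<Longrightarrow> F_lower T x y = 0"
    and M: "sets M = sets (restrict_space borel X)" "prob_space M" "invariant_measure T M"
    and N: "sets N = sets (restrict_space borel X)" "prob_space N" "invariant_measure T N"
    and f: "continuous_on X f"
  shows "(\<integral>x. f x \<partial>N) \<le> (\<integral>x. f x \<partial>M)"
proof (rule ccontr)
  \<comment> \<open>A quarter of the gap: one \<open>d\<close> is lost at each of the points
    \<open>x\<close> and \<open>y\<close> and one in the modulus of \<open>f\<close>, which leaves
    \<open>d \<le> K * F_avg T x y n\<close> at every positive time.\<close>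
  define d where "d = ((\<integral>x. f x \<partial>N) - (\<integral>x. f x \<partial>M)) / 4"
  assume "\<not> ?thesis"
  then have d: "0 < d" by (simp add: d_def)
  obtain x where x: "x \<in> X" "\<And>n. 0 < n \<Longrightarrow> orbit_avg T f x n \<le> (\<integral>x. f x \<partial>M) + d"
    using orbit_avg_le_for_all_times[OF M f, of "(\<integral>x. f x \<partial>M) + d"] d by auto
  have nf: "continuous_on X (\<lambda>x. - f x)" using f by (rule continuous_on_minus)
  have neg: "orbit_avg T (\<lambda>x. - f x) y n = - orbit_avg T f y n" for y n
    by (simp add: orbit_avg_def sum_negf)
  obtain y where y: "y \<in> X" "\<And>n. 0 < n \<Longrightarrow> - orbit_avg T f y n \<le> - (\<integral>x. f x \<partial>N) + d"
    using orbit_avg_le_for_all_times[OF N nf, of "- (\<integral>x. f x \<partial>N) + d"] d neg by auto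
  obtain K where K: "0 < K" "\<And>u v. u \<in> X \<Longrightarrow> v \<in> X \<Longrightarrow> \<bar>f u - f v\<bar> \<le> d + K * dist u v"
    using continuous_le_linear_modulus[OF f d] by metis
  have "d / K \<le> F_avg T x y n" if n: "0 < n" for n
  proof -
    have "2 * d \<le> \<bar>orbit_avg T f x n - orbit_avg T f y n\<bar>"
      using x(2)[OF n] y(2)[OF n] abs_ge_minus_self[of "orbit_avg T f x n - orbit_avg T f y n"]
      by (simp add: d_def field_simps)
    then show ?thesis
      using orbit_avg_diff_le_F_avg[OF K x(1) y(1) n] K(1) by (simp add: divide_le_eq mult.commute)
  qed
  then have "eventually (\<lambda>n. ereal (d / K) \<le> ereal (F_avg T x y n)) sequentially"
    by (auto intro: eventually_mono[OF eventually_gt_at_top[of 0]])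
  then have "ereal (d / K) \<le> F_lower T x y" unfolding F_lower_def by (rule Liminf_bounded)
  then show False using F[OF x(1) y(1)] divide_pos_pos[OF d K(1)] by (simp add: zero_ereal_def)
qed

text \<open>The integral inequality is symmetric in the two measures, so all continuous integrals
  agree.\<close>

lemma F_lower_zero_imp_uniquely_ergodic:
  assumes F: "\<And>x y. x \<in> X \<Longrightarrow> y \<in> X \<Longrightarrow> F_lower T x y = 0"
  shows "uniquely_ergodic X T"
proof -
  have "\<exists>M. regular_borel_prob X M \<and> ergodic_measure T M"
    using maximizing_ergodic_measure[OF X_ne X T continuous_on_const[of X 0]] by metis
  moreover have "M = N"
    if M: "regular_borel_prob X M" "ergodic_measure T M" and N: "regular_borel_prob X N" "ergodic_measure T N" for M N
  proof -
    have M': "sets M = sets (restrict_space borel X)" "prob_space M" "invariant_measure T M"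
      and N': "sets N = sets (restrict_space borel X)" "prob_space N" "invariant_measure T N"
      using M N by (auto simp: regular_borel_prob_def ergodic_measure_def)
    show ?thesis
    proof (rule continuous_integrals_determine_measure[OF X M'(1) _ N'(1)])
      show "finite_measure M" "finite_measure N" using M'(2) N'(2) by (auto intro: prob_space.finite_measure)
      show "(\<integral>x. f x \<partial>M) = (\<integral>x. f x \<partial>N)" if "continuous_on X f" for f :: "'a \<Rightarrow> real"
        using F_lower_zero_imp_integral_le[OF F M' N' that] F_lower_zero_imp_integral_le[OF F N' M' that]
        by simp
    qed
  qed
  ultimately show ?thesis unfolding uniquely_ergodic_def by blast
qed

end

theorem theorem1p2:
  fixes X :: "'a::metric_space set" and T :: "'a \<Rightarrow> 'a"
  assumes "X \<noteq> {}" and "compact X" and "continuous_on X T" and "T ` X \<subseteq> X"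
  shows "(uniquely_ergodic X T \<longleftrightarrow> N_F X T = X \<times> X) \<and>
         (N_F X T = X \<times> X \<longleftrightarrow> N_F_lower X T = X \<times> X)"
proof -
  have "N_F X T = X \<times> X" if ue: "uniquely_ergodic X T"
  proof -
    have "F_upper T x y = 0 \<and> F_lower T x y = 0" if "x \<in> X" "y \<in> X" for x y
    proof -
      have "(\<lambda>n. ereal (F_avg T x y n)) \<longlonglongrightarrow> ereal 0"
        using uniquely_ergodic_imp_F_avg_tendsto_0[OF assms ue that] by simp
      then show ?thesis
        unfolding F_upper_def F_lower_def
        by (simp add: lim_imp_Limsup lim_imp_Liminf zero_ereal_def)
    qed
    then show ?thesis by (auto simp: N_F_def F_exists_def F_val_def)
  qed
  \<comment> \<open>These inclusions give the passage from \<open>N_F\<close> to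
    \<open>N_F_lower\<close>; with the two implications on either side they close the cycle.\<close>
  moreover have "N_F X T \<subseteq> N_F_lower X T" "N_F_lower X T \<subseteq> X \<times> X"
    by (auto simp: N_F_def N_F_lower_def F_exists_def F_val_def)
  moreover have "uniquely_ergodic X T" if "N_F_lower X T = X \<times> X"
  proof (rule F_lower_zero_imp_uniquely_ergodic[OF assms])
    fix x y assume "x \<in> X" "y \<in> X"
    then have "(x, y) \<in> N_F_lower X T" using that by simp
    then show "F_lower T x y = 0" by (simp add: N_F_lower_def)
  qed
  ultimately show ?thesis by blast
qed

end
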